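(* Let $\mathbb{P}$ be the unique Gibbs measure on $\Omega=\mathcal{A}^{\mathbb{Z}}$ with interaction $U\in\mathcal{U}$, let $\alpha = p(U)-\frac{p(2U)}{2}$ (which is strictly positive) and $k^*(n)=\frac{\ln n}{\alpha}$. Let $\sigma,\eta$ be independent, each with distribution $\mathbb{P}$ (so that $(\sigma,\eta)$ has law $\mathbb{P}\otimes\mathbb{P}$), and let $N(\sigma,\eta,n,k)$ be the number of matches with shift of length $k$. Let $\{k(n)\}_{n\in\mathbb{N}}$ be a sequence of integers. Then: 1. If $k^*(n)-k(n)\to\infty$ as $n\to\infty$, then for every positive integer $m$, $\lim_{n\to\infty}\mathbb{P}\otimes\mathbb{P}[N(\sigma,\eta,n,k(n))\le m]=0$. 2. If $k(n)-k^*(n)\to\infty$ as $n\to\infty$, then for every positive integer $m$, $\lim_{n\to\infty}\mathbb{P}\otimes\mathbb{P}[N(\sigma,\eta,n,k(n))\ge m]=0$. 3. If $k(n)-k^*(n)$ is bounded, then $N(\sigma,\eta,n,k(n))$ is tight and does not converge to zero in distribution. More precisely, there exists a constant $C>0$ such that for every positive integer $m$ $$\limsup_{n\to\infty}\mathbb{P}\otimes\mathbb{P}(N(\sigma,\eta,n,k(n))>m)\le\frac{C}{m},$$ and $$\liminf_{n\to\infty}\mathbb{P}\otimes\mathbb{P}(N(\sigma,\eta,n,k(n))>0)>0.$$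
   Context: $\mathcal{A}$ is a finite set with at least two elements; $\Omega=\mathcal{A}^{\mathbb{Z}}$ with the product topology and product sigma-field; $\mathcal{S}$ is the set of (nonempty) finite subsets of $\mathbb{Z}$; for $V\subseteq\mathbb{Z}$, $\sigma_V$ is the restriction of $\sigma\in\Omega$ to $V$, $\Omega_V=\mathcal{A}^V$, and $\mathcal{F}_V$ is the sigma-field generated by $\{\sigma(i):i\in V\}$. The shift is $(\tau_i\sigma)(j)=\sigma(i+j)$. $\operatorname{diam}(A)=\max\{|i-j|:i,j\in A\}$. $C_k=\{1,\dots,k\}$. Interactions: $\mathcal{U}$ is the set of maps $U:\mathcal{S}\times\Omega\to\mathbb{R}$ such that (i) $\sigma\mapsto U(A,\sigma)$ is $\mathcal{F}_A$-measurable for all $A\in\mathcal{S}$; (ii) $U(A+i,\tau_{-i}\sigma)=U(A,\sigma)$ for all $A\in\mathcal{S}$, $i\in\mathbb{Z}$, $\sigma\in\Omega$; (iii) there is $\gamma>0$ with $\sum_{A\ni 0}e^{\gamma\operatorname{diam}(A)}\sup_{\sigma\in\Omega}|U(A,\sigma)|<\infty$. For real $q$, $(qU)(A,\sigma)=q\,U(A,\sigma)$. Gibbs measures: for $\Lambda\in\mathcal{S}$, $\zeta\in\Omega$, put $H_\Lambda^\zeta(\sigma)=\sum_{A\cap\Lambda\ne\varnothing}U(A,\sigma_\Lambda\zeta_{\Lambda^c})$, where $\sigma_\Lambda\zeta_{\Lambda^c}$ equals $\sigma$ on $\Lambda$ and $\zeta$ off $\Lambda$. A probability measure $\mathbb{P}$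 on $\Omega$ is a Gibbs measure with interaction $U$ if for all $\Lambda\in\mathcal{S}$ the conditional distribution of $\sigma_\Lambda$ given $\sigma_{\Lambda^c}=\zeta_{\Lambda^c}$ is, for $\mathbb{P}$-a.e. $\zeta$, given by the weights $e^{-H_\Lambda^\zeta(\sigma)}/\sum_{\sigma'_\Lambda\in\Omega_\Lambda}e^{-H_\Lambda^\zeta(\sigma')}$. For $U\in\mathcal{U}$ there is exactly one Gibbs measure with interaction $U$. Pressure: $p(U)=\lim_{n\to\infty}\frac1n\log\sum_{\sigma_{C_n}\in\Omega_{C_n}}\exp\bigl(-\sum_{A\subseteq C_n}U(A,\sigma)\bigr)$. Number of shift-matches for two strings: for $\sigma,\eta\in\Omega$ and integers $1\le k<n$, $N(\sigma,\eta,n,k)=\sum_{i=0}^{n-k}\sum_{j=0,\,j\ne i}^{n-k}\mathbb{1}\{(\tau_i\sigma)_{C_k}=(\tau_j\eta)_{C_k}\}$. Sequences $k(n)$ are understood to satisfy $1\le k(n)<n$ for all sufficiently large $n$, so that $N(\sigma,\eta,n,k(n))$ is defined. *)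

theory Defs
  imports "HOL-Probability.Probability"
begin

type_synonym 'a config = "int \<Rightarrow> 'a"

text \<open>The alphabet is a finite type; elements of \<open>\<Omega>\<^sub>V\<close> are represented as extensional functions,
  so that \<open>restrict \<sigma> V\<close> is the restriction of \<open>\<sigma>\<close> to \<open>V\<close>.\<close>

definition Omega :: "'a::finite config measure" where
  "Omega = (\<Pi>\<^sub>M i\<in>UNIV. count_space UNIV)"

definition Omega_on :: "int set \<Rightarrow> 'a::finite config set" where
  "Omega_on V = V \<rightarrow>\<^sub>E UNIV"

definition F_on :: "int set \<Rightarrow> 'a::finite config measure" where
  "F_on V = sigma UNIV {{\<sigma>. \<sigma> i \<in> B} | i B. i \<in> V}"

definition tau :: "int \<Rightarrow> 'a config \<Rightarrow> 'a config" where
  "tau i \<sigma> = (\<lambda>j. \<sigma> (i + j))"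

definition C_block :: "int \<Rightarrow> int set" where
  "C_block k = {1..k}"

definition finite_regions :: "int set set" where
  "finite_regions = {A. finite A \<and> A \<noteq> {}}"

definition diam :: "int set \<Rightarrow> int" where
  "diam A = Max {\<bar>i - j\<bar> | i j. i \<in> A \<and> j \<in> A}"

text \<open>Interactions are functions on all sets of integers; their values outside
  \<^const>\<open>finite_regions\<close> are never used. The supremum below is over a bounded set, since a function
  measurable with respect to \<open>F_on A\<close> takes only finitely many values when \<open>A\<close> is finite.\<close>

definition interactions :: "(int set \<Rightarrow> 'a::finite config \<Rightarrow> real) set" where
  "interactions = {U.
     (\<forall>A\<in>finite_regions. U A \<in> borel_measurable (F_on A)) \<and>
     (\<forall>A\<in>finite_regions. \<forall>i \<sigma>. U ((\<lambda>a. a + i) ` A) (tau (- i) \<sigma>) = U A \<sigma>) \<and>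
     (\<exists>\<gamma>>0. (\<lambda>A. exp (\<gamma> * real_of_int (diam A)) * (SUP \<sigma>. \<bar>U A \<sigma>\<bar>))
        summable_on {A\<in>finite_regions. 0 \<in> A})}"

text \<open>For an interaction the following sum converges absolutely. The configuration
  \<open>override_on \<zeta> \<sigma> \<Lambda>\<close> equals \<open>\<sigma>\<close> on \<open>\<Lambda>\<close> and \<open>\<zeta>\<close> elsewhere.\<close>

definition hamiltonian ::
  "(int set \<Rightarrow> 'a::finite config \<Rightarrow> real) \<Rightarrow> int set \<Rightarrow> 'a config \<Rightarrow> 'a config \<Rightarrow> real" where
  "hamiltonian U \<Lambda> \<zeta> \<sigma> =
     (\<Sum>\<^sub>\<infinity>A\<in>{A\<in>finite_regions. A \<inter> \<Lambda> \<noteq> {}}. U A (override_on \<zeta> \<sigma> \<Lambda>))"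

text \<open>\<open>\<Omega>\<^sub>\<Lambda>\<close> is finite, so the conditional distribution of \<open>\<sigma>\<^sub>\<Lambda>\<close> given the configuration outside
  \<open>\<Lambda>\<close> is determined by the conditional probabilities of the events \<open>\<sigma>\<^sub>\<Lambda> = \<xi>\<close>, that is, by the
  conditional expectations of their indicators given \<open>F_on (- \<Lambda>)\<close>.\<close>

definition gibbs_measure ::
  "(int set \<Rightarrow> 'a::finite config \<Rightarrow> real) \<Rightarrow> 'a config measure \<Rightarrow> bool" where
  "gibbs_measure U P \<longleftrightarrow> prob_space P \<and> sets P = sets Omega \<and>
     (\<forall>\<Lambda>\<in>finite_regions. AE \<zeta> in P. \<forall>\<xi>\<in>Omega_on \<Lambda>.
        real_cond_exp P (F_on (- \<Lambda>)) (indicator {\<sigma>. restrict \<sigma> \<Lambda> = \<xi>}) \<zeta> =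
          exp (- hamiltonian U \<Lambda> \<zeta> \<xi>) / (\<Sum>\<xi>'\<in>Omega_on \<Lambda>. exp (- hamiltonian U \<Lambda> \<zeta> \<xi>')))"

text \<open>In the pressure, an element of \<open>\<Omega>\<^bsub>C_block n\<^esub>\<close> is itself used as the configuration extending it;
  the extension is irrelevant because \<open>U A\<close> depends only on the coordinates in \<open>A\<close>.\<close>

definition pressure :: "(int set \<Rightarrow> 'a::finite config \<Rightarrow> real) \<Rightarrow> real" where
  "pressure U = lim (\<lambda>n::nat. 1 / real n *
     ln (\<Sum>\<sigma>\<in>Omega_on (C_block (int n)). exp (- (\<Sum>A\<in>{A\<in>finite_regions. A \<subseteq> C_block (int n)}. U A \<sigma>))))"

definition N_matches :: "'a config \<Rightarrow> 'a config \<Rightarrow> nat \<Rightarrow> int \<Rightarrow> nat" where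
  "N_matches \<sigma> \<eta> n k = (\<Sum>i\<in>{0..int n - k}. \<Sum>j\<in>{0..int n - k} - {i}.
     of_bool (restrict (tau i \<sigma>) (C_block k) = restrict (tau j \<eta>) (C_block k)))"

end

theory Submission
  imports Defs
begin

text \<open>Everything is done up to multiplicative constants. The energy carried by the regions that cross
  a bond is bounded, so the conditional law of the word in a window given the configuration outside
  agrees, up to a constant factor, with the free-boundary Gibbs weights of the window, and
  the logarithms of the partition functions are additive up to a bounded error. Hence two independent
  words of length \<open>k\<close> coincide with probability of order \<open>exp (- 2 \<alpha> k)\<close>, and \<open>\<alpha> > 0\<close> because
  cylinder probabilities decay exponentially.

  The first moment and Markov's inequality give part 2 and tightness. By Cauchy--Schwarz,
  the probability that the windows \<open>(i, j)\<close> and \<open>(i', j')\<close> both match is at most a constant times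
  \<open>exp (- \<alpha> (2 k + min k \<bar>i - i'\<bar> + min k \<bar>j - j'\<bar>))\<close>, so the second moment method bounds the
  probability of a match from below as soon as \<open>r exp (- \<alpha> k)\<close> is bounded below, where \<open>r\<close> is the
  number of windows. For part 1 the interval is cut into a fixed number \<open>G\<close> of blocks; whatever happens
  outside, each block contains a match with probability at least some \<open>c > 0\<close> that does not depend on
  \<open>G\<close>, so that \<open>m\<close> or fewer matches occur with probability at most \<open>2 ^ m (1 - c / 2) ^ G\<close>.\<close>

section \<open>Near-additive sequences\<close>

text \<open>Bounded multiplicative errors are forced by the critical regime: when \<open>k n\<close>
  stays within O(1) of \<open>kstar n\<close>, the expected number of matches is of order one, and
  an error factor exp (o(k)), which is all that the existence of the limit defining the pressure
  provides, would swamp it. Two-sided near-additivity with a bounded defect turns that limit into an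
  O(1) estimate for the logarithms of the partition functions. The price is that first and second
  moments are known only up to constants. The second moment method therefore yields a match with
  probability bounded below, but not close to one, however large the mean is; this is why part 1
  needs the amplification over blocks. The estimates are uniform in the outside configuration, so
  adjacent blocks can be used without gaps. With r starting positions the natural parameter is u = r
  exp (- \<alpha> k): the mean is of order u^2, and the second moment is at most of order u^2 (S +
  u)^2, where S is a geometric series over the displacements of overlapping windows.\<close>

lemma near_additive_multiple:
  fixes a :: "nat \<Rightarrow> real"
  assumes "\<And>m n. \<bar>a (m + n) - a m - a n\<bar> \<le> c"
  shows "\<bar>a (m * n) - real m * a n\<bar> \<le> (real m + 1) * c"
proof (induction m)
  case 0
  show ?case using assms[of 0 0] by simp
next
  case (Suc m)
  then show ?case using assms[of n "m * n"] by (simp add: algebra_simps abs_le_iff)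
qed

text \<open>Reading \<open>m * n\<close> both as m blocks of length n and as n blocks of length m
  compares the two averages at once, with an explicit Cauchy rate. Letting one index tend to
  infinity then turns this rate into the bounded error.\<close>

lemma near_additive_limit:
  fixes a :: "nat \<Rightarrow> real"
  assumes add: "\<And>m n. \<bar>a (m + n) - a m - a n\<bar> \<le> c"
  obtains L where "(\<lambda>n. a n / real n) \<longlonglongrightarrow> L" "\<And>n. \<bar>a n - real n * L\<bar> \<le> 2 * c"
proof -
  have c: "c \<ge> 0" using add[of 0 0] by linarith
  have close: "\<bar>a m / real m - a n / real n\<bar> \<le> 2 * c / real m + 2 * c / real n"
    if "m \<ge> 1" "n \<ge> 1" for m n
  proof -
    have "\<bar>real n * a m - real m * a n\<bar> \<le> (real m + 1) * c + (real n + 1) * c"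
      using near_additive_multiple[of a c, OF add, of m n]
        near_additive_multiple[of a c, OF add, of n m]
      by (simp add: mult.commute)
    \<comment> \<open>For m at least 1, m + 1 is at most 2 m; this is the origin of the factor 2 in
      the conclusion.\<close>
    also have "\<dots> \<le> 2 * real m * c + 2 * real n * c"
      using that c by (intro add_mono mult_right_mono) auto
    finally have "\<bar>real n * a m - real m * a n\<bar> / (real m * real n)
        \<le> (2 * real m * c + 2 * real n * c) / (real m * real n)"
      using that by (intro divide_right_mono) auto
    moreover have "\<bar>real n * a m - real m * a n\<bar> / (real m * real n)
        = \<bar>(real n * a m - real m * a n) / (real m * real n)\<bar>"
      by (simp add: abs_divide abs_mult)
    moreover have "(real n * a m - real m * a n) / (real m * real n) = a m / real m - a n / real n"
      using that by (simp add: field_simps)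
    moreover have "(2 * real m * c + 2 * real n * c) / (real m * real n) = 2 * c / real m + 2 * c / real n"
      using that by (simp add: field_simps)
    ultimately show ?thesis by simp
  qed
  have "Cauchy (\<lambda>n. a n / real n)"
  proof (rule metric_CauchyI)
    fix e :: real assume "e > 0"
    obtain N where N: "real N > 4 * c / e" using reals_Archimedean2 by blast
    have "dist (a m / real m) (a n / real n) < e" if "m \<ge> Suc N" "n \<ge> Suc N" for m n
    proof -
      have small: "2 * c / real k < e / 2" if "k \<ge> Suc N" for k
      proof -
        have "4 * c < e * real N" using N \<open>e > 0\<close> by (simp add: field_simps)
        also have "\<dots> \<le> e * real k" using that \<open>e > 0\<close> by (intro mult_left_mono) auto
        finally show ?thesis using that by (simp add: field_simps)
      qed
      show ?thesis
        using close[of m n] that small[OF that(1)] small[OF that(2)] by (simp add: dist_real_def)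
    qed
    then show "\<exists>M. \<forall>m\<ge>M. \<forall>n\<ge>M. dist (a m / real m) (a n / real n) < e" by blast
  qed
  then obtain L where L: "(\<lambda>n. a n / real n) \<longlonglongrightarrow> L"
    using Cauchy_convergent_iff convergent_def by blast
  have "\<bar>a n - real n * L\<bar> \<le> 2 * c" for n
  proof (cases "n = 0")
    case True
    then show ?thesis using add[of 0 0] c by simp
  next
    case False
    \<comment> \<open>Pass to the limit in m in \<open>close\<close> with n fixed; the term 2 c / m
      disappears.\<close>
    have "(\<lambda>m. \<bar>a m / real m - a n / real n\<bar>) \<longlonglongrightarrow> \<bar>L - a n / real n\<bar>"
      by (intro tendsto_intros L)
    moreover have "(\<lambda>m. 2 * c / real m + 2 * c / real n) \<longlonglongrightarrow> 0 + 2 * c / real n"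
      by (intro tendsto_intros tendsto_divide_0[OF tendsto_const] filterlim_real_sequentially
          filterlim_mono[OF filterlim_real_sequentially at_top_le_at_infinity order_refl])
    ultimately have "\<bar>L - a n / real n\<bar> \<le> 0 + 2 * c / real n"
      using False
      by (intro tendsto_le[OF trivial_limit_sequentially, rotated])
        (auto intro!: eventually_sequentiallyI[of 1] close)
    then have "real n * \<bar>L - a n / real n\<bar> \<le> 2 * c" using False by (simp add: field_simps)
    moreover have "real n * \<bar>L - a n / real n\<bar> = \<bar>real n * (L - a n / real n)\<bar>"
      by (simp add: abs_mult)
    moreover have "real n * (L - a n / real n) = real n * L - a n"
      using False by (simp add: field_simps)
    ultimately show ?thesis by (simp add: abs_minus_commute)
  qed
  with L show ?thesis using that by blast
qed

section \<open>Energy of an interaction\<close>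

text \<open>Not distinguishing configurations that agree on V passes to complements and countable
  unions, so it suffices to look at the generators. This turns the measurability condition on
  interactions into pointwise locality.\<close>

lemma sets_F_on_agree:
  assumes "S \<in> sets (F_on V)" "\<And>i. i \<in> V \<Longrightarrow> \<sigma> i = \<sigma>' i"
  shows "\<sigma> \<in> S \<longleftrightarrow> \<sigma>' \<in> S"
proof -
  have "S \<in> sigma_sets UNIV {{\<sigma>. \<sigma> i \<in> B} | i B. i \<in> V}"
    using assms(1) by (simp add: F_on_def)
  then show ?thesis
    by induction (use assms(2) in auto)
qed

lemma space_F_on [simp]: "space (F_on V) = UNIV"
  by (simp add: F_on_def space_measure_of_conv)

lemma borel_measurable_F_on_agree:
  fixes f :: "'a::finite config \<Rightarrow> real"
  assumes "f \<in> borel_measurable (F_on V)" "\<And>i. i \<in> V \<Longrightarrow> \<sigma> i = \<sigma>' i"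
  shows "f \<sigma> = f \<sigma>'"
proof -
  have "f -` {f \<sigma>} \<inter> space (F_on V) \<in> sets (F_on V)"
    using assms(1) by (intro measurable_sets) auto
  from sets_F_on_agree[OF this, of \<sigma> \<sigma>'] assms(2) show ?thesis by auto
qed

lemma finite_Omega_on [simp]: "finite V \<Longrightarrow> finite (Omega_on V :: 'a::finite config set)"
  by (simp add: Omega_on_def finite_PiE)

lemma restrict_in_Omega_on [simp]: "restrict \<sigma> V \<in> Omega_on V"
  by (simp add: Omega_on_def)

lemma Omega_on_nonempty [simp]: "Omega_on V \<noteq> {}"
  using restrict_in_Omega_on by blast

definition sup_norm :: "(int set \<Rightarrow> 'a::finite config \<Rightarrow> real) \<Rightarrow> int set \<Rightarrow> real" where
  "sup_norm U A = (SUP \<sigma>. \<bar>U A \<sigma>\<bar>)"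

text \<open>The bond joins a and a + 1. The window \<open>{a+1..a+k}\<close> is bounded by the bonds
  a and a + k.\<close>

definition crossing :: "int \<Rightarrow> int set set" where
  "crossing a = {A \<in> finite_regions. (\<exists>i\<in>A. i \<le> a) \<and> (\<exists>j\<in>A. a < j)}"

text \<open>Summing over all regions that contain 0, rather than over translation classes, counts a
  class several times, which is harmless in an upper bound.\<close>

definition bond_norm :: "(int set \<Rightarrow> 'a::finite config \<Rightarrow> real) \<Rightarrow> real" where
  "bond_norm U = (\<Sum>\<^sub>\<infinity>A\<in>{A\<in>finite_regions. 0 \<in> A}. real_of_int (diam A) * sup_norm U A)"

definition region_energy ::
  "(int set \<Rightarrow> 'a::finite config \<Rightarrow> real) \<Rightarrow> int set \<Rightarrow> 'a config \<Rightarrow> real" where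
  "region_energy U V \<sigma> = (\<Sum>A\<in>{A\<in>finite_regions. A \<subseteq> V}. U A \<sigma>)"

text \<open>The parameter \<beta> is kept apart from the interaction, so that p(U) and p(2U) are
  both obtained inside the locale of \<open>U\<close>, with the same
  \<open>bond_norm\<close>.\<close>

definition partition_fun ::
  "(int set \<Rightarrow> 'a::finite config \<Rightarrow> real) \<Rightarrow> real \<Rightarrow> int \<Rightarrow> real" where
  "partition_fun U \<beta> k = (\<Sum>\<sigma>\<in>Omega_on {1..k}. exp (- (\<beta> * region_energy U {1..k} \<sigma>)))"

section \<open>Diameters and translations of finite regions\<close>

lemma diam_ge:
  assumes "finite A" "i \<in> A" "j \<in> A"
  shows "\<bar>i - j\<bar> \<le> diam A"
proof -
  have "finite ((\<lambda>(i, j). \<bar>i - j\<bar>) ` (A \<times> A))" using assms by simp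
  also have "(\<lambda>(i, j). \<bar>i - j\<bar>) ` (A \<times> A) = {\<bar>i - j\<bar> | i j. i \<in> A \<and> j \<in> A}" by auto
  finally show ?thesis unfolding diam_def using assms by (intro Max_ge) auto
qed

lemma diam_translate: "diam ((\<lambda>a. a + i) ` A) = diam A"
proof -
  have "{\<bar>x - y\<bar> | x y. x \<in> B \<and> y \<in> B} = (\<lambda>(x, y). \<bar>x - y\<bar>) ` (B \<times> B)" for B :: "int set"
    by auto
  moreover have "(\<lambda>(x, y). \<bar>x - y\<bar>) ` ((\<lambda>a. a + i) ` A \<times> (\<lambda>a. a + i) ` A)
      = (\<lambda>(x, y). \<bar>x - y\<bar>) ` (A \<times> A)"
    by (force simp: image_iff)
  ultimately show ?thesis by (simp add: diam_def)
qed

lemma finite_regions_translate [simp]: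
  "(\<lambda>a. a + i) ` A \<in> finite_regions \<longleftrightarrow> A \<in> finite_regions"
  by (simp add: finite_regions_def finite_image_iff inj_on_def)

lemma diam_nonneg: "A \<in> finite_regions \<Longrightarrow> 0 \<le> diam A"
proof -
  assume "A \<in> finite_regions"
  then obtain i where "finite A" "i \<in> A" by (auto simp: finite_regions_def)
  from diam_ge[OF this this(2)] show ?thesis by simp
qed

lemma tau_tau [simp]: "tau i (tau j \<sigma>) = tau (i + j) \<sigma>" "tau 0 \<sigma> = \<sigma>"
proof -
  have "j + (i + k) = i + j + k" for k by simp
  then show "tau i (tau j \<sigma>) = tau (i + j) \<sigma>" by (simp only: tau_def)
  show "tau 0 \<sigma> = \<sigma>" by (simp add: tau_def)
qed

text \<open>Passes from finite families, for which boundary energies are estimated by counting, to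
  the infinite sum in \<open>hamiltonian\<close>.\<close>

lemma sums_bounded_infsum:
  fixes f u :: "'b \<Rightarrow> real"
  assumes "\<And>x. x \<in> S \<Longrightarrow> \<bar>f x\<bar> \<le> u x"
    and "\<And>F. finite F \<Longrightarrow> F \<subseteq> S \<Longrightarrow> sum u F \<le> B"
  shows "f summable_on S" "\<bar>infsum f S\<bar> \<le> B"
proof -
  have fin: "(\<Sum>x\<in>F. \<bar>f x\<bar>) \<le> B" if "finite F" "F \<subseteq> S" for F
  proof -
    have "(\<Sum>x\<in>F. \<bar>f x\<bar>) \<le> sum u F" using assms(1) that(2) by (intro sum_mono) auto
    with assms(2)[OF that] show ?thesis by linarith
  qed
  have abs: "(\<lambda>x. norm (f x)) summable_on S"
    using fin by (intro nonneg_bdd_above_summable_on bdd_aboveI2[where M = B]) auto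
  then show "f summable_on S" by (rule abs_summable_summable)
  have "norm (infsum f S) \<le> infsum (\<lambda>x. norm (f x)) S" by (rule norm_infsum_bound[OF abs])
  also have "\<dots> \<le> B" using fin by (intro infsum_le_finite_sums[OF abs]) auto
  finally show "\<bar>infsum f S\<bar> \<le> B" by simp
qed

section \<open>Locality, translation and boundary energy of a fixed interaction\<close>

locale interaction =
  fixes U :: "int set \<Rightarrow> 'a::finite config \<Rightarrow> real"
  assumes U: "U \<in> interactions"
begin

lemma U_agree:
  assumes "A \<in> finite_regions" "\<And>i. i \<in> A \<Longrightarrow> \<sigma> i = \<sigma>' i"
  shows "U A \<sigma> = U A \<sigma>'"
proof (rule borel_measurable_F_on_agree)
  show "U A \<in> borel_measurable (F_on A)" using U assms(1) unfolding interactions_def by blast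
qed (use assms(2) in blast)

lemma U_translate: "A \<in> finite_regions \<Longrightarrow> U ((\<lambda>a. a + i) ` A) \<sigma> = U A (tau i \<sigma>)"
proof -
  assume "A \<in> finite_regions"
  then have "U ((\<lambda>a. a + i) ` A) (tau (- i) (tau i \<sigma>)) = U A (tau i \<sigma>)"
    using U unfolding interactions_def by blast
  then show ?thesis by simp
qed

lemma bdd_above_U: assumes "A \<in> finite_regions" shows "bdd_above (range (\<lambda>\<sigma>. \<bar>U A \<sigma>\<bar>))"
proof -
  have "range (\<lambda>\<sigma>. \<bar>U A \<sigma>\<bar>) \<subseteq> (\<lambda>\<sigma>. \<bar>U A \<sigma>\<bar>) ` Omega_on A"
  proof (intro image_subsetI)
    fix \<sigma> show "\<bar>U A \<sigma>\<bar> \<in> (\<lambda>\<sigma>. \<bar>U A \<sigma>\<bar>) ` Omega_on A"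
    proof (rule image_eqI)
      show "\<bar>U A \<sigma>\<bar> = \<bar>U A (restrict \<sigma> A)\<bar>"
        by (rule arg_cong[where f = abs], rule U_agree[OF assms]) simp
    qed simp
  qed
  moreover have "finite A" using assms by (simp add: finite_regions_def)
  ultimately show ?thesis by (meson bdd_above.I finite_Omega_on finite_imageI bdd_above_finite bdd_above_mono)
qed

lemma abs_U_le: "A \<in> finite_regions \<Longrightarrow> \<bar>U A \<sigma>\<bar> \<le> sup_norm U A"
  unfolding sup_norm_def by (intro cSUP_upper bdd_above_U) auto

lemma sup_norm_nonneg: "A \<in> finite_regions \<Longrightarrow> 0 \<le> sup_norm U A"
  using abs_U_le[of A undefined] by linarith

lemma sup_norm_translate:
  assumes "A \<in> finite_regions" shows "sup_norm U ((\<lambda>a. a + i) ` A) = sup_norm U A"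
proof -
  have "range (\<lambda>\<sigma>. \<bar>U A (tau i \<sigma>)\<bar>) = range (\<lambda>\<sigma>. \<bar>U A \<sigma>\<bar>)"
  proof (intro equalityI image_subsetI)
    fix \<sigma> show "\<bar>U A \<sigma>\<bar> \<in> range (\<lambda>\<sigma>. \<bar>U A (tau i \<sigma>)\<bar>)"
      by (intro image_eqI[where x = "tau (- i) \<sigma>"]) auto
  qed auto
  then show ?thesis unfolding sup_norm_def by (simp add: U_translate[OF assms])
qed

text \<open>The assumed exponential weight dominates the linear one, because \<gamma> d is at most
  exp (\<gamma> d).\<close>

lemma diam_sup_norm_summable:
  "(\<lambda>A. real_of_int (diam A) * sup_norm U A) summable_on {A\<in>finite_regions. 0 \<in> A}"
proof -
  obtain \<gamma> where \<gamma>: "\<gamma> > 0"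
    and sm: "(\<lambda>A. exp (\<gamma> * real_of_int (diam A)) * sup_norm U A) summable_on {A\<in>finite_regions. 0 \<in> A}"
    using U unfolding interactions_def sup_norm_def by blast
  from summable_on_cmult_right[OF sm, of "1 / \<gamma>"] show ?thesis
  proof (rule summable_on_comparison_test)
    fix A assume A: "A \<in> {A\<in>finite_regions. 0 \<in> A}"
    have "\<gamma> * real_of_int (diam A) \<le> exp (\<gamma> * real_of_int (diam A))"
      using exp_ge_add_one_self[of "\<gamma> * real_of_int (diam A)"] by linarith
    then have "real_of_int (diam A) \<le> 1 / \<gamma> * exp (\<gamma> * real_of_int (diam A))"
      using \<gamma> by (simp add: field_simps)
    then show "real_of_int (diam A) * sup_norm U A \<le> 1 / \<gamma> * (exp (\<gamma> * real_of_int (diam A)) * sup_norm U A)"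
      using A sup_norm_nonneg[of A] by (metis (no_types, lifting) mem_Collect_eq mult.assoc mult_right_mono)
    show "0 \<le> real_of_int (diam A) * sup_norm U A"
      using A sup_norm_nonneg[of A] diam_nonneg[of A] by simp
  qed
qed

text \<open>A translation class of regions of diameter \<open>d\<close> has at most \<open>d\<close> members crossing a given
  bond, which is where the weight \<open>diam A\<close> in \<^const>\<open>bond_norm\<close> comes from.\<close>

lemma sum_crossing_le:
  assumes "finite F" "F \<subseteq> crossing a"
  shows "sum (sup_norm U) F \<le> bond_norm U"
proof -
  \<comment> \<open>The representative of a translation class with minimum 0.\<close>
  define nrm where "nrm A = (\<lambda>x. x + (- Min A)) ` A" for A :: "int set"
  have fr: "A \<in> finite_regions" if "A \<in> F" for A using that assms by (auto simp: crossing_def)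
  have nrm: "nrm A \<in> finite_regions" "0 \<in> nrm A" "diam (nrm A) = diam A"
      "sup_norm U (nrm A) = sup_norm U A" if "A \<in> F" for A
  proof -
    have "Min A \<in> A" using fr[OF that] by (simp add: finite_regions_def)
    then show "0 \<in> nrm A" unfolding nrm_def by (intro image_eqI[where x = "Min A"]) auto
    show "nrm A \<in> finite_regions" unfolding nrm_def by (simp only: finite_regions_translate fr[OF that])
    show "diam (nrm A) = diam A" unfolding nrm_def by (simp only: diam_translate)
    show "sup_norm U (nrm A) = sup_norm U A" unfolding nrm_def by (simp only: sup_norm_translate fr[OF that])
  qed
  \<comment> \<open>Within a class of diameter d a region is determined by its minimum. Crossing the
    bond puts one point at or below a and another above a, so the minimum is one of the d integers
    ending at a.\<close>
  have fibre: "card {A\<in>F. nrm A = B} \<le> nat (diam B)" if "B \<in> nrm ` F" for B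
  proof -
    have "inj_on Min {A\<in>F. nrm A = B}"
    proof (rule inj_onI)
      fix A A' assume "A \<in> {A\<in>F. nrm A = B}" "A' \<in> {A\<in>F. nrm A = B}" "Min A = Min A'"
      then have "(\<lambda>x. x - Min A) ` A = (\<lambda>x. x - Min A) ` A'" by (simp add: nrm_def)
      then show "A = A'" by (subst (asm) inj_image_eq_iff) (auto simp: inj_on_def)
    qed
    moreover have "Min ` {A\<in>F. nrm A = B} \<subseteq> {a - diam B<..a}"
    proof (intro image_subsetI)
      fix A assume A: "A \<in> {A\<in>F. nrm A = B}"
      then obtain i j where ij: "i \<in> A" "i \<le> a" "j \<in> A" "a < j" using assms by (auto simp: crossing_def)
      have fin: "finite A" "A \<noteq> {}" using fr A by (auto simp: finite_regions_def)
      have "Min A \<le> i" using fin ij by simp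
      moreover have "\<bar>j - Min A\<bar> \<le> diam A" using fin ij by (intro diam_ge) auto
      moreover have "diam A = diam B" using nrm(3) A by auto
      ultimately show "Min A \<in> {a - diam B<..a}" using ij by auto
    qed
    ultimately have "card {A\<in>F. nrm A = B} \<le> card {a - diam B<..a}"
      by (intro card_inj_on_le) auto
    then show ?thesis by simp
  qed
  have "sum (sup_norm U) F = (\<Sum>B\<in>nrm ` F. \<Sum>A\<in>{A\<in>F. nrm A = B}. sup_norm U A)"
    by (rule sum.image_gen[OF assms(1)])
  also have "\<dots> = (\<Sum>B\<in>nrm ` F. real (card {A\<in>F. nrm A = B}) * sup_norm U B)"
  proof (rule sum.cong[OF refl])
    fix B
    have "(\<Sum>A\<in>{A\<in>F. nrm A = B}. sup_norm U A) = (\<Sum>A\<in>{A\<in>F. nrm A = B}. sup_norm U B)"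
      using nrm(4) by (intro sum.cong) auto
    then show "(\<Sum>A\<in>{A\<in>F. nrm A = B}. sup_norm U A) = real (card {A\<in>F. nrm A = B}) * sup_norm U B" by simp
  qed
  also have "\<dots> \<le> (\<Sum>B\<in>nrm ` F. real_of_int (diam B) * sup_norm U B)"
  proof (intro sum_mono mult_right_mono)
    fix B assume B: "B \<in> nrm ` F"
    then have "B \<in> finite_regions" using nrm by auto
    then show "0 \<le> sup_norm U B" "real (card {A\<in>F. nrm A = B}) \<le> real_of_int (diam B)"
      using sup_norm_nonneg diam_nonneg[of B] fibre[OF B] by auto
  qed
  also have "\<dots> \<le> bond_norm U"
    unfolding bond_norm_def using assms nrm
    by (intro finite_sum_le_infsum diam_sup_norm_summable) (auto simp: sup_norm_nonneg diam_nonneg)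
  finally show ?thesis .
qed

lemma bond_norm_nonneg: "0 \<le> bond_norm U"
  using sum_crossing_le[of "{}"] by simp

lemma region_energy_agree:
  assumes "\<And>i. i \<in> V \<Longrightarrow> \<sigma> i = \<sigma>' i"
  shows "region_energy U V \<sigma> = region_energy U V \<sigma>'"
  unfolding region_energy_def using assms by (intro sum.cong U_agree) auto

lemma region_energy_translate: "region_energy U {i+1..i+k} \<sigma> = region_energy U {1..k} (tau i \<sigma>)"
proof -
  have "region_energy U {1..k} (tau i \<sigma>) = (\<Sum>A\<in>{A\<in>finite_regions. A \<subseteq> {1..k}}. U ((\<lambda>a. a + i) ` A) \<sigma>)"
    unfolding region_energy_def by (intro sum.cong) (auto simp: U_translate)
  also have "\<dots> = region_energy U {i+1..i+k} \<sigma>"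
    unfolding region_energy_def
  proof (rule sum.reindex_bij_witness[where i = "\<lambda>A. (\<lambda>a. a + (- i)) ` A" and j = "\<lambda>A. (\<lambda>a. a + i) ` A"])
    fix A assume A: "A \<in> {A\<in>finite_regions. A \<subseteq> {1..k}}"
    then have "(\<lambda>a. a + i) ` A \<subseteq> (\<lambda>a. a + i) ` {1..k}" by (intro image_mono) simp
    with A show "(\<lambda>a. a + i) ` A \<in> {A\<in>finite_regions. A \<subseteq> {i+1..i+k}}"
      by (simp add: add.commute)
  next
    fix A assume A: "A \<in> {A\<in>finite_regions. A \<subseteq> {i+1..i+k}}"
    then have "(\<lambda>a. a + (- i)) ` A \<subseteq> (\<lambda>a. a + (- i)) ` {i+1..i+k}" by (intro image_mono) simp
    also have "\<dots> = {1..k}" by simp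
    finally show "(\<lambda>a. a + (- i)) ` A \<in> {A\<in>finite_regions. A \<subseteq> {1..k}}"
      using A finite_regions_translate[of "- i" A] by (simp only: mem_Collect_eq simp_thms)
  qed (simp_all add: image_image)
  finally show ?thesis ..
qed

text \<open>A region meeting the window is either contained in it, where only \<xi> is seen, or
  crosses one of its two boundary bonds; hence the factor 2. All later uniformity in the outside
  configuration comes from the uniformity in \<zeta> here.\<close>

lemma hamiltonian_bound:
  "\<bar>hamiltonian U {a+1..a+k} \<zeta> \<xi> - region_energy U {a+1..a+k} \<xi>\<bar> \<le> 2 * bond_norm U"
proof -
  define \<Lambda> where "\<Lambda> = {a+1..a+k}"
  define f where "f A = U A (override_on \<zeta> \<xi> \<Lambda>)" for A
  define I where "I = {A\<in>finite_regions. A \<subseteq> \<Lambda>}"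
  define R where "R = {A\<in>finite_regions. A \<inter> \<Lambda> \<noteq> {} \<and> \<not> A \<subseteq> \<Lambda>}"
  have finI: "finite I" by (rule finite_subset[of _ "Pow \<Lambda>"]) (auto simp: I_def \<Lambda>_def)
  have R: "R \<subseteq> crossing a \<union> crossing (a + k)"
  proof
    fix A assume "A \<in> R"
    then obtain x y where "A \<in> finite_regions" "x \<in> A" "x \<in> \<Lambda>" "y \<in> A" "y \<notin> \<Lambda>" by (auto simp: R_def)
    then show "A \<in> crossing a \<union> crossing (a + k)"
      by (cases "y \<le> a") (force simp: crossing_def \<Lambda>_def)+
  qed
  have bound: "sum (sup_norm U) F \<le> 2 * bond_norm U" if F: "finite F" "F \<subseteq> R" for F
  proof -
    \<comment> \<open>Regions crossing both bonds are charged to the left one.\<close>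
    have "sum (sup_norm U) F = sum (sup_norm U) (F \<inter> crossing a) + sum (sup_norm U) (F - crossing a)"
      using F by (intro sum.Int_Diff) simp
    also have "\<dots> \<le> bond_norm U + bond_norm U"
      using F R by (intro add_mono sum_crossing_le[of _ a] sum_crossing_le[of _ "a + k"]) auto
    finally show ?thesis by simp
  qed
  have f: "\<bar>f A\<bar> \<le> sup_norm U A" if "A \<in> R" for A
    using that abs_U_le by (auto simp: f_def R_def)
  note sb = sums_bounded_infsum[of R f, OF f bound]
  have "{A\<in>finite_regions. A \<inter> \<Lambda> \<noteq> {}} = I \<union> R" by (auto simp: I_def R_def finite_regions_def)
  then have "hamiltonian U \<Lambda> \<zeta> \<xi> = infsum f (I \<union> R)" unfolding hamiltonian_def f_def by simp
  also have "\<dots> = sum f I + infsum f R"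
    using finI sb(1) by (subst infsum_Un_disjoint) (auto simp: I_def R_def)
  also have "sum f I = region_energy U \<Lambda> \<xi>"
    unfolding region_energy_def I_def f_def by (intro sum.cong U_agree) auto
  finally show ?thesis using sb(2) by (simp add: \<Lambda>_def)
qed

text \<open>Cutting at m loses exactly the regions inside \<open>{1..m+n}\<close> that cross this
  single bond.\<close>

lemma region_energy_split:
  assumes "0 \<le> m" "0 \<le> n"
  shows "\<bar>region_energy U {1..m+n} \<sigma> - region_energy U {1..m} \<sigma> - region_energy U {1..n} (tau m \<sigma>)\<bar> \<le> bond_norm U"
proof -
  define S where "S V = {A\<in>finite_regions. A \<subseteq> V}" for V :: "int set"
  define R where "R = S {1..m+n} - S {1..m} - S {m+1..m+n}"
  have fin: "finite (S V)" if "finite V" for V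
    by (rule finite_subset[of _ "Pow V"]) (use that in \<open>auto simp: S_def\<close>)
  have R: "R \<subseteq> crossing m"
  proof
    fix A assume "A \<in> R"
    then have "A \<in> finite_regions" "A \<subseteq> {1..m+n}" "\<not> A \<subseteq> {1..m}" "\<not> A \<subseteq> {m+1..m+n}"
      by (simp_all add: R_def S_def)
    then obtain x y where "A \<in> finite_regions" "A \<subseteq> {1..m+n}" "x \<in> A" "x \<notin> {1..m}" "y \<in> A" "y \<notin> {m+1..m+n}"
      by blast
    moreover from this have "x \<in> {1..m+n}" "y \<in> {1..m+n}" by blast+
    ultimately have "m < x" "y \<le> m" by auto
    then show "A \<in> crossing m"
      using \<open>A \<in> finite_regions\<close> \<open>x \<in> A\<close> \<open>y \<in> A\<close> unfolding crossing_def by blast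
  qed
  have disj: "S {1..m} \<inter> S {m+1..m+n} = {}"
  proof -
    have "{1..m} \<inter> {m+1..m+n} = {}" by auto
    then show ?thesis unfolding S_def finite_regions_def by blast
  qed
  have sub: "S {1..m} \<subseteq> S {1..m+n}" "S {m+1..m+n} \<subseteq> S {1..m+n}"
    using assms by (auto simp: S_def)
  have "S {1..m+n} = S {1..m} \<union> S {m+1..m+n} \<union> R" using sub by (auto simp: R_def)
  then have "region_energy U {1..m+n} \<sigma> = (\<Sum>A\<in>S {1..m} \<union> S {m+1..m+n} \<union> R. U A \<sigma>)"
    by (simp add: region_energy_def S_def)
  also have "\<dots> = (\<Sum>A\<in>S {1..m} \<union> S {m+1..m+n}. U A \<sigma>) + (\<Sum>A\<in>R. U A \<sigma>)"
    by (rule sum.union_disjoint) (auto simp: fin R_def)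
  also have "(\<Sum>A\<in>S {1..m} \<union> S {m+1..m+n}. U A \<sigma>) = (\<Sum>A\<in>S {1..m}. U A \<sigma>) + (\<Sum>A\<in>S {m+1..m+n}. U A \<sigma>)"
    by (rule sum.union_disjoint[OF _ _ disj]) (auto simp: fin)
  also have "\<dots> = region_energy U {1..m} \<sigma> + region_energy U {m+1..m+n} \<sigma>"
    by (simp add: region_energy_def S_def)
  finally have "\<bar>region_energy U {1..m+n} \<sigma> - region_energy U {1..m} \<sigma> - region_energy U {1..n} (tau m \<sigma>)\<bar>
      = \<bar>\<Sum>A\<in>R. U A \<sigma>\<bar>"
    using region_energy_translate[of m n \<sigma>] by simp
  also have "\<dots> \<le> sum (sup_norm U) R"
    by (rule order_trans[OF sum_abs]) (auto intro!: sum_mono abs_U_le simp: R_def S_def)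
  also have "\<dots> \<le> bond_norm U" using fin R by (intro sum_crossing_le[of _ m]) (auto simp: R_def)
  finally show ?thesis .
qed

section \<open>Partition functions and pressure\<close>

lemma partition_fun_pos: "0 < partition_fun U \<beta> k"
  unfolding partition_fun_def by (intro sum_pos) auto

lemma Omega_on_append:
  assumes "0 \<le> m" "0 \<le> n"
  shows "bij_betw (\<lambda>\<sigma>. (restrict \<sigma> {1..m}, restrict (tau m \<sigma>) {1..n}))
    (Omega_on {1..m+n}) (Omega_on {1..m} \<times> (Omega_on {1..n} :: 'a config set))"
proof (rule bij_betw_byWitness[where f' = "\<lambda>(x, y) t. if t \<in> {1..m} then x t else
      if t \<in> {m+1..m+n} then y (t - m) else undefined"])
qed (use assms in \<open>auto simp: Omega_on_def tau_def fun_eq_iff PiE_def extensional_def restrict_def\<close>)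

text \<open>Gluing words identifies the product of two partition functions with a sum over words of
  length m + n, after which the sums are compared term by term.\<close>

lemma partition_fun_split:
  assumes "0 \<le> m" "0 \<le> n" "0 \<le> \<beta>"
  shows "partition_fun U \<beta> (m + n) \<le> exp (\<beta> * bond_norm U) * (partition_fun U \<beta> m * partition_fun U \<beta> n)"
    and "partition_fun U \<beta> m * partition_fun U \<beta> n \<le> exp (\<beta> * bond_norm U) * partition_fun U \<beta> (m + n)"
proof -
  define w where "w k \<sigma> = exp (- (\<beta> * region_energy U {1..k} \<sigma>))" for k and \<sigma> :: "'a config"
  have prod: "partition_fun U \<beta> m * partition_fun U \<beta> n
      = (\<Sum>\<sigma>\<in>Omega_on {1..m+n}. w m \<sigma> * w n (tau m \<sigma>))"
  proof -
    have "partition_fun U \<beta> m * partition_fun U \<beta> n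
        = (\<Sum>(x, y)\<in>Omega_on {1..m} \<times> Omega_on {1..n}. w m x * w n y)"
      by (simp add: partition_fun_def w_def sum_product sum.cartesian_product)
    also have "\<dots> = (\<Sum>\<sigma>\<in>Omega_on {1..m+n}. w m (restrict \<sigma> {1..m}) * w n (restrict (tau m \<sigma>) {1..n}))"
      by (subst sum.reindex_bij_betw[OF Omega_on_append[OF assms(1,2)], symmetric]) simp
    also have "\<dots> = (\<Sum>\<sigma>\<in>Omega_on {1..m+n}. w m \<sigma> * w n (tau m \<sigma>))"
      unfolding w_def
      by (intro sum.cong arg_cong2[where f = "(*)"] arg_cong[where f = exp] arg_cong[where f = uminus]
          arg_cong[where f = "(*) \<beta>"] region_energy_agree) auto
    finally show ?thesis .
  qed
  have bounds: "w (m + n) \<sigma> \<le> exp (\<beta> * bond_norm U) * (w m \<sigma> * w n (tau m \<sigma>)) \<and>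
      w m \<sigma> * w n (tau m \<sigma>) \<le> exp (\<beta> * bond_norm U) * w (m + n) \<sigma>" for \<sigma>
  proof -
    have "\<beta> * \<bar>region_energy U {1..m+n} \<sigma> - region_energy U {1..m} \<sigma> - region_energy U {1..n} (tau m \<sigma>)\<bar>
        \<le> \<beta> * bond_norm U"
      by (intro mult_left_mono region_energy_split assms)
    then have "\<bar>\<beta> * (region_energy U {1..m+n} \<sigma> - region_energy U {1..m} \<sigma> - region_energy U {1..n} (tau m \<sigma>))\<bar>
        \<le> \<beta> * bond_norm U"
      using assms(3) by (simp add: abs_mult)
    then show ?thesis
      unfolding w_def by (auto simp: exp_add[symmetric] algebra_simps abs_le_iff)
  qed
  show "partition_fun U \<beta> (m + n) \<le> exp (\<beta> * bond_norm U) * (partition_fun U \<beta> m * partition_fun U \<beta> n)"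
    unfolding prod unfolding partition_fun_def sum_distrib_left using bounds by (intro sum_mono) (simp add: w_def)
  show "partition_fun U \<beta> m * partition_fun U \<beta> n \<le> exp (\<beta> * bond_norm U) * partition_fun U \<beta> (m + n)"
    unfolding prod unfolding partition_fun_def sum_distrib_left using bounds by (intro sum_mono) (simp add: w_def)
qed

lemma ln_partition_fun_split:
  assumes "0 \<le> \<beta>"
  shows "\<bar>ln (partition_fun U \<beta> (int (m + n))) - ln (partition_fun U \<beta> (int m)) - ln (partition_fun U \<beta> (int n))\<bar>
    \<le> \<beta> * bond_norm U"
proof -
  note pos = partition_fun_pos[of \<beta>]
  have "ln (partition_fun U \<beta> (int m + int n)) \<le>
      ln (exp (\<beta> * bond_norm U) * (partition_fun U \<beta> (int m) * partition_fun U \<beta> (int n)))"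
    using pos partition_fun_split(1)[of "int m" "int n" \<beta>] assms by (subst ln_le_cancel_iff) auto
  moreover have "ln (partition_fun U \<beta> (int m) * partition_fun U \<beta> (int n)) \<le>
      ln (exp (\<beta> * bond_norm U) * partition_fun U \<beta> (int m + int n))"
    using pos partition_fun_split(2)[of "int m" "int n" \<beta>] assms by (subst ln_le_cancel_iff) auto
  ultimately show ?thesis using pos by (auto simp: ln_mult_pos abs_le_iff)
qed

definition press :: "real \<Rightarrow> real" where
  "press \<beta> = lim (\<lambda>n. ln (partition_fun U \<beta> (int n)) / real n)"

lemma ln_partition_fun_press:
  assumes "0 \<le> \<beta>"
  shows "\<bar>ln (partition_fun U \<beta> (int n)) - real n * press \<beta>\<bar> \<le> 2 * (\<beta> * bond_norm U)"
proof -
  obtain L where L: "(\<lambda>n. ln (partition_fun U \<beta> (int n)) / real n) \<longlonglongrightarrow> L"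
    "\<And>n. \<bar>ln (partition_fun U \<beta> (int n)) - real n * L\<bar> \<le> 2 * (\<beta> * bond_norm U)"
    using near_additive_limit[of "\<lambda>n. ln (partition_fun U \<beta> (int n))" "\<beta> * bond_norm U"]
      ln_partition_fun_split[OF assms] by blast
  from L(1) have "press \<beta> = L" unfolding press_def by (rule limI)
  with L(2) show ?thesis by simp
qed

lemma pressure_mult: "pressure (\<lambda>A \<sigma>. \<beta> * U A \<sigma>) = press \<beta>"
  by (simp add: pressure_def press_def partition_fun_def region_energy_def C_block_def sum_distrib_left)

text \<open>The finite-volume Gibbs distribution with free boundary condition; it is the reference
  law to which words under \<open>P\<close> are compared.\<close>

definition weight :: "int \<Rightarrow> 'a config \<Rightarrow> real" where
  "weight k \<sigma> = exp (- region_energy U {1..k} \<sigma>) / partition_fun U 1 k"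

text \<open>The probability that two independent samples from \<^const>\<open>weight\<close> coincide.\<close>

definition coll :: "int \<Rightarrow> real" where
  "coll k = (\<Sum>x\<in>Omega_on {1..k}. (weight k x)\<^sup>2)"

lemma weight_pos: "0 < weight k x"
  by (simp add: weight_def partition_fun_pos)

lemma sum_weight: "(\<Sum>x\<in>Omega_on {1..k}. weight k x) = 1"
  using partition_fun_pos[of 1 k]
  by (simp add: weight_def sum_divide_distrib[symmetric]) (simp add: partition_fun_def)

lemma coll_nonneg: "0 \<le> coll k"
  by (simp add: coll_def sum_nonneg)

text \<open>Squaring a weight doubles the energy: this is how the pressure of the doubled
  interaction enters \<alpha>.\<close>

lemma coll_eq: "coll k = partition_fun U 2 k / (partition_fun U 1 k)\<^sup>2"
  by (simp add: coll_def weight_def partition_fun_def power_divide sum_divide_distrib exp_double[symmetric] exp_minus[symmetric])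

text \<open>In ln (coll k) = ln Z(2) - 2 ln Z(1) each of the two terms has error at most 4 times
  \<open>bond_norm U\<close>, which gives the 8.\<close>

lemma coll_bounds:
  assumes "0 \<le> k"
  defines "\<alpha> \<equiv> press 1 - press 2 / 2"
  shows "coll k \<le> exp (8 * bond_norm U) * exp (- 2 * \<alpha> * real_of_int k)"
    and "exp (- 2 * \<alpha> * real_of_int k) \<le> exp (8 * bond_norm U) * coll k"
proof -
  obtain n where n: "k = int n" using assms(1) nonneg_int_cases by blast
  note pos = partition_fun_pos
  have "ln (coll k) = ln (partition_fun U 2 (int n)) - 2 * ln (partition_fun U 1 (int n))"
    using pos[of 1 k] pos[of 2 k] by (simp add: coll_eq n ln_div ln_realpow)
  then have bound: "\<bar>ln (coll k) + 2 * \<alpha> * real_of_int k\<bar> \<le> 8 * bond_norm U"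
    using ln_partition_fun_press[of 1 n] ln_partition_fun_press[of 2 n]
    unfolding \<alpha>_def abs_le_iff n by (simp add: algebra_simps)
  have "0 < coll k" using pos[of 1 k] pos[of 2 k] by (simp add: coll_eq)
  then have eq: "coll k = exp (ln (coll k))" by simp
  have "ln (coll k) \<le> 8 * bond_norm U + (- 2 * \<alpha> * real_of_int k)"
    and "- 2 * \<alpha> * real_of_int k \<le> 8 * bond_norm U + ln (coll k)"
    using bound by (auto simp: abs_le_iff)
  then show "coll k \<le> exp (8 * bond_norm U) * exp (- 2 * \<alpha> * real_of_int k)"
    "exp (- 2 * \<alpha> * real_of_int k) \<le> exp (8 * bond_norm U) * coll k"
    using eq by (metis exp_add exp_le_cancel_iff)+
qed

end

section \<open>Words under a Gibbs measure\<close>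

text \<open>The word is indexed by \<open>{1..k}\<close> whatever the offset a, so that one word can
  be compared at different positions of different configurations.\<close>

definition cyl :: "int \<Rightarrow> int \<Rightarrow> 'a config \<Rightarrow> 'a config set" where
  "cyl a k x = {\<sigma>. \<forall>t\<in>{1..k}. \<sigma> (a + t) = x t}"

text \<open>The case i = j is allowed although the count omits it: such events control all others
  through Cauchy--Schwarz.\<close>

definition match_event :: "int \<Rightarrow> int \<Rightarrow> int \<Rightarrow> ('a config \<times> 'a config) set" where
  "match_event i j k = {\<omega>. \<forall>t\<in>{1..k}. fst \<omega> (i + t) = snd \<omega> (j + t)}"

lemma cyl_iff: "x \<in> Omega_on {1..k} \<Longrightarrow> \<sigma> \<in> cyl a k x \<longleftrightarrow> x = restrict (tau a \<sigma>) {1..k}"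
  by (auto simp: cyl_def Omega_on_def tau_def fun_eq_iff restrict_def PiE_def extensional_def)

text \<open>The words of a window partition the configurations, so exactly one summand
  survives.\<close>

lemma sum_cyl:
  fixes f :: "'a::finite config \<Rightarrow> real"
  shows "(\<Sum>x\<in>Omega_on {1..k}. f x * indicator (cyl a k x) \<sigma>) = f (restrict (tau a \<sigma>) {1..k})"
proof -
  have "(\<Sum>x\<in>Omega_on {1..k}. f x * indicator (cyl a k x) \<sigma>)
      = (\<Sum>x\<in>Omega_on {1..k}. if x = restrict (tau a \<sigma>) {1..k} then f x else 0)"
    by (intro sum.cong) (auto simp: cyl_iff)
  then show ?thesis by simp
qed

text \<open>Splitting by the common word writes a match as a disjoint union of rectangles, to which
  independence of the two configurations applies.\<close>

lemma indicator_match_event: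
  "(indicator (match_event i j k) (\<sigma>, \<eta>) :: real) =
    (\<Sum>x\<in>Omega_on {1..k}. indicator (cyl i k x) \<sigma> * indicator (cyl j k x) (\<eta> :: 'a::finite config))"
proof -
  have "(\<Sum>x\<in>Omega_on {1..k}. indicator (cyl i k x) \<sigma> * indicator (cyl j k x) \<eta>)
      = (indicator (cyl i k (restrict (tau j \<eta>) {1..k})) \<sigma> :: real)"
    by (rule sum_cyl)
  then show ?thesis
    by (simp add: match_event_def cyl_def tau_def indicator_def)
qed

locale gibbs = interaction U for U :: "int set \<Rightarrow> 'a::finite config \<Rightarrow> real" +
  fixes P :: "'a config measure"
  assumes G: "gibbs_measure U P"
begin

sublocale prob_space P
  using G by (simp add: gibbs_measure_def)

lemma sets_P [measurable_cong]: "sets P = sets (\<Pi>\<^sub>M i\<in>UNIV. count_space UNIV)"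
  using G by (simp add: gibbs_measure_def Omega_def)

lemma space_P [simp]: "space P = UNIV"
  using sets_eq_imp_space_eq[OF sets_P] by (simp add: space_PiM)

lemma coord_measurable [measurable]: "(\<lambda>\<sigma>. \<sigma> j) \<in> measurable P (count_space UNIV)"
  by measurable

lemma subalgebra_F_on: "subalgebra P (F_on V)"
proof -
  have "{\<sigma>. \<sigma> i \<in> B} \<in> sets P" for i B
    using measurable_sets[OF coord_measurable, of B i] by (simp add: vimage_def)
  then have "sigma_sets (space P) {{\<sigma>. \<sigma> i \<in> B} | i B. i \<in> V} \<subseteq> sets P"
    by (intro sets.sigma_sets_subset) auto
  then show ?thesis by (simp add: subalgebra_def F_on_def space_measure_of_conv)
qed

text \<open>Resetting the coordinates in V to a fixed configuration is measurable for the
  sigma-field of the outside and leaves g unchanged. Conditional expectations can then be used with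
  any g known only through the coordinates it depends on.\<close>

lemma measurable_F_on_complement:
  fixes g :: "'a config \<Rightarrow> real"
  assumes g: "g \<in> borel_measurable P"
    and off: "\<And>\<sigma> \<sigma>'. (\<And>i. i \<notin> V \<Longrightarrow> \<sigma> i = \<sigma>' i) \<Longrightarrow> g \<sigma> = g \<sigma>'"
  shows "g \<in> borel_measurable (F_on (- V))"
proof -
  define h where "h \<sigma> = override_on \<sigma> undefined V" for \<sigma> :: "'a config"
  have "(\<lambda>\<sigma>. h \<sigma> i) \<in> measurable (F_on (- V)) (count_space UNIV)" for i
  proof (cases "i \<in> V")
    case False
    have "(\<lambda>\<sigma> :: 'a config. \<sigma> i) \<in> measurable (F_on (- V)) (count_space UNIV)"
    proof (rule measurableI)
      fix B :: "'a set"
      have "{\<sigma>. \<sigma> i \<in> B} \<in> sigma_sets UNIV {{\<sigma>. \<sigma> i \<in> B} | i B. i \<in> - V}"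
        using False by (intro sigma_sets.Basic) auto
      then show "(\<lambda>\<sigma>. \<sigma> i) -` B \<inter> space (F_on (- V)) \<in> sets (F_on (- V))"
        by (simp add: F_on_def vimage_def space_measure_of_conv)
    qed simp
    with False show ?thesis by (simp add: h_def)
  qed (simp add: h_def)
  then have "h \<in> measurable (F_on (- V)) (\<Pi>\<^sub>M i\<in>UNIV. count_space UNIV)"
    by (intro measurable_PiM_single') auto
  then have "h \<in> measurable (F_on (- V)) P"
    by (simp add: measurable_cong_sets[OF refl sets_P])
  from measurable_compose[OF this g] have "(\<lambda>\<sigma>. g (h \<sigma>)) \<in> borel_measurable (F_on (- V))" .
  moreover have "g (h \<sigma>) = g \<sigma>" for \<sigma> by (rule off) (simp add: h_def)
  ultimately show ?thesis by simp
qed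

lemma cyl_sets [measurable]: "cyl a k x \<in> sets P"
proof -
  have "{\<sigma>\<in>space P. \<forall>t\<in>{1..k}. \<sigma> (a + t) = x t} \<in> sets P" by measurable
  then show ?thesis by (simp add: cyl_def)
qed

text \<open>One factor \<open>exp (2 * bond_norm U)\<close> for the Gibbs weight and one for its
  normalisation.\<close>

definition K where "K = exp (4 * bond_norm U)"

lemma K_ge_1: "1 \<le> K"
  by (simp add: K_def bond_norm_nonneg)

lemma Omega_on_translate:
  "bij_betw (\<lambda>x. restrict (tau (- a) x) {a+1..a+k}) (Omega_on {1..k}) (Omega_on {a+1..a+k} :: 'a config set)"
proof (rule bij_betw_byWitness[where f' = "\<lambda>\<xi>. restrict (tau a \<xi>) {1..k}"])
qed (auto simp: Omega_on_def tau_def fun_eq_iff PiE_def extensional_def restrict_def)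

text \<open>\<open>hamiltonian_bound\<close> applies to the numerator and to every term of the
  normalising sum, for each \<zeta>. Moving the window to \<open>{1..k}\<close> makes the reference
  weight independent of the position a.\<close>

lemma gibbs_kernel_bounds:
  fixes x \<zeta> :: "'a config" and a k :: int
  defines "\<Lambda> \<equiv> {a+1..a+k}"
  defines "\<xi> \<equiv> restrict (tau (- a) x) \<Lambda>"
  defines "w \<equiv> exp (- hamiltonian U \<Lambda> \<zeta> \<xi>) / (\<Sum>\<xi>'\<in>Omega_on \<Lambda>. exp (- hamiltonian U \<Lambda> \<zeta> \<xi>'))"
  shows "weight k x \<le> K * w" "w \<le> K * weight k x"
proof -
  define b where "b = bond_norm U"
  define h where "h \<xi> = exp (- hamiltonian U \<Lambda> \<zeta> \<xi>)" for \<xi>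
  define e where "e \<xi> = exp (- region_energy U \<Lambda> \<xi>)" for \<xi>
  have le: "h \<xi> \<le> exp (2 * b) * e \<xi>" "e \<xi> \<le> exp (2 * b) * h \<xi>" for \<xi>
    using hamiltonian_bound[of a k \<zeta> \<xi>]
    by (auto simp: h_def e_def \<Lambda>_def b_def exp_add[symmetric] abs_le_iff)
  have e: "e (restrict (tau (- a) y) \<Lambda>) = exp (- region_energy U {1..k} y)" for y
  proof -
    have "region_energy U \<Lambda> (restrict (tau (- a) y) \<Lambda>) = region_energy U \<Lambda> (tau (- a) y)"
      by (rule region_energy_agree) simp
    then show ?thesis by (simp add: e_def \<Lambda>_def region_energy_translate)
  qed
  have "(\<Sum>\<xi>\<in>Omega_on \<Lambda>. e \<xi>) = (\<Sum>y\<in>Omega_on {1..k}. e (restrict (tau (- a) y) \<Lambda>))"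
    unfolding \<Lambda>_def by (rule sum.reindex_bij_betw[OF Omega_on_translate, symmetric])
  then have Z: "(\<Sum>\<xi>\<in>Omega_on \<Lambda>. e \<xi>) = partition_fun U 1 k"
    by (simp add: e partition_fun_def)
  have w: "w = h \<xi> / (\<Sum>\<xi>\<in>Omega_on \<Lambda>. h \<xi>)" by (simp add: w_def h_def)
  have weight: "weight k x = e \<xi> / (\<Sum>\<xi>\<in>Omega_on \<Lambda>. e \<xi>)" by (simp add: Z e \<xi>_def weight_def)
  have fin: "finite (Omega_on \<Lambda> :: 'a config set)" by (simp add: \<Lambda>_def)
  have pos: "(\<Sum>\<xi>\<in>Omega_on \<Lambda>. h \<xi>) > 0" "(\<Sum>\<xi>\<in>Omega_on \<Lambda>. e \<xi>) > 0"
    using fin by (auto intro!: sum_pos simp: h_def e_def)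
  have Zle: "(\<Sum>\<xi>\<in>Omega_on \<Lambda>. h \<xi>) \<le> exp (2 * b) * (\<Sum>\<xi>\<in>Omega_on \<Lambda>. e \<xi>)"
    "(\<Sum>\<xi>\<in>Omega_on \<Lambda>. e \<xi>) \<le> exp (2 * b) * (\<Sum>\<xi>\<in>Omega_on \<Lambda>. h \<xi>)"
    unfolding sum_distrib_left by (intro sum_mono le)+
  have K: "K = exp (2 * b) * exp (2 * b)" by (simp add: K_def b_def exp_add[symmetric])
  have nonneg: "0 \<le> h \<xi>" "0 \<le> e \<xi>" by (auto simp: h_def e_def)
  have ratio: "u / v \<le> K * (u' / v')"
    if "u \<le> exp (2 * b) * u'" "v' \<le> exp (2 * b) * v" "v > 0" "v' > 0" "0 \<le> u" "0 \<le> u'" for u v u' v' :: real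
  proof -
    have "u * v' \<le> (exp (2 * b) * u') * (exp (2 * b) * v)"
      using that by (intro mult_mono) auto
    then show ?thesis using that by (simp add: K field_simps)
  qed
  show "weight k x \<le> K * w" "w \<le> K * weight k x"
    unfolding w weight by (intro ratio le Zle pos nonneg)+
qed

text \<open>As g is measurable outside the window, it can be taken out of the conditional
  expectation, and the conditional probability of the word is comparable to \<open>weight\<close>.
  The Gibbs conditional probabilities enter the argument only here. A function g instead of an event
  is allowed because fibre integrals and products of block factors are inserted later.\<close>

lemma cyl_quasi_indep:
  assumes k: "1 \<le> k"
    and g[measurable]: "g \<in> borel_measurable P"
    and g01: "\<And>\<sigma>. 0 \<le> g \<sigma>" "\<And>\<sigma>. g \<sigma> \<le> (1::real)"
    and off: "\<And>\<sigma> \<sigma>'. (\<And>i. i \<notin> {a+1..a+k} \<Longrightarrow> \<sigma> i = \<sigma>' i) \<Longrightarrow> g \<sigma> = g \<sigma>'"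
  shows "weight k x * (\<integral>\<sigma>. g \<sigma> \<partial>P) \<le> K * (\<integral>\<sigma>. g \<sigma> * indicator (cyl a k x) \<sigma> \<partial>P)"
    and "(\<integral>\<sigma>. g \<sigma> * indicator (cyl a k x) \<sigma> \<partial>P) \<le> K * weight k x * (\<integral>\<sigma>. g \<sigma> \<partial>P)"
proof -
  define \<Lambda> where "\<Lambda> = {a+1..a+k}"
  define \<xi> where "\<xi> = restrict (tau (- a) x) \<Lambda>"
  define w where "w \<zeta> = exp (- hamiltonian U \<Lambda> \<zeta> \<xi>) / (\<Sum>\<xi>'\<in>Omega_on \<Lambda>. exp (- hamiltonian U \<Lambda> \<zeta> \<xi>'))" for \<zeta>
  let ?r = "real_cond_exp P (F_on (- \<Lambda>)) (indicator (cyl a k x))"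
  interpret sub: finite_measure_subalgebra P "F_on (- \<Lambda>)"
    by unfold_locales (rule subalgebra_F_on)
  \<comment> \<open>\<xi> is x moved into the window, so the event in \<open>gibbs_measure\<close>
    is the cylinder of x.\<close>
  have cyl: "{\<sigma>. restrict \<sigma> \<Lambda> = \<xi>} = cyl a k x"
  proof (intro set_eqI iffI)
    fix \<sigma> assume "\<sigma> \<in> {\<sigma>. restrict \<sigma> \<Lambda> = \<xi>}"
    then have eq: "restrict \<sigma> \<Lambda> i = \<xi> i" for i by simp
    have "\<sigma> (a + t) = x t" if "t \<in> {1..k}" for t
      using eq[of "a + t"] that by (auto simp: \<Lambda>_def \<xi>_def tau_def)
    then show "\<sigma> \<in> cyl a k x" unfolding cyl_def by blast
  next
    fix \<sigma> assume \<sigma>: "\<sigma> \<in> cyl a k x"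
    have "\<sigma> i = x (- a + i)" if "i \<in> \<Lambda>" for i
    proof -
      have "- a + i \<in> {1..k}" using that by (auto simp: \<Lambda>_def)
      with \<sigma> have "\<sigma> (a + (- a + i)) = x (- a + i)" unfolding cyl_def by blast
      then show ?thesis by simp
    qed
    then show "\<sigma> \<in> {\<sigma>. restrict \<sigma> \<Lambda> = \<xi>}" by (auto simp: \<xi>_def tau_def fun_eq_iff)
  qed
  have \<Lambda>: "\<Lambda> \<in> finite_regions" using k by (auto simp: finite_regions_def \<Lambda>_def)
  with G have "AE \<zeta> in P. \<forall>\<xi>\<in>Omega_on \<Lambda>.
        real_cond_exp P (F_on (- \<Lambda>)) (indicator {\<sigma>. restrict \<sigma> \<Lambda> = \<xi>}) \<zeta> =
          exp (- hamiltonian U \<Lambda> \<zeta> \<xi>) / (\<Sum>\<xi>'\<in>Omega_on \<Lambda>. exp (- hamiltonian U \<Lambda> \<zeta> \<xi>'))"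
    unfolding gibbs_measure_def by blast
  then have ae: "AE \<zeta> in P. ?r \<zeta> = w \<zeta>"
  proof (rule AE_mp, intro AE_I2 impI)
    fix \<zeta> assume "\<forall>\<xi>\<in>Omega_on \<Lambda>.
        real_cond_exp P (F_on (- \<Lambda>)) (indicator {\<sigma>. restrict \<sigma> \<Lambda> = \<xi>}) \<zeta> =
          exp (- hamiltonian U \<Lambda> \<zeta> \<xi>) / (\<Sum>\<xi>'\<in>Omega_on \<Lambda>. exp (- hamiltonian U \<Lambda> \<zeta> \<xi>'))"
    then have "real_cond_exp P (F_on (- \<Lambda>)) (indicator {\<sigma>. restrict \<sigma> \<Lambda> = \<xi>}) \<zeta> = w \<zeta>"
      unfolding w_def \<xi>_def by (rule bspec) simp
    then show "?r \<zeta> = w \<zeta>" by (simp only: cyl)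
  qed
  have wb: "weight k x \<le> K * w \<zeta>" "w \<zeta> \<le> K * weight k x" for \<zeta>
    unfolding w_def \<xi>_def \<Lambda>_def by (rule gibbs_kernel_bounds)+
  have K: "K > 0" by (simp add: K_def)
  have int: "integrable P g" "integrable P (\<lambda>\<sigma>. g \<sigma> * indicator (cyl a k x) \<sigma>)"
    using g01 by (auto intro!: integrable_const_bound[where B = 1] simp: indicator_def)
  have gF: "g \<in> borel_measurable (F_on (- \<Lambda>))"
    unfolding \<Lambda>_def using off by (rule measurable_F_on_complement[OF g])
  have "(indicator (cyl a k x) :: _ \<Rightarrow> real) \<in> borel_measurable P" by simp
  note r = sub.real_cond_exp_intg[OF int(2) gF this]
  have int_r: "integrable P (\<lambda>\<zeta>. g \<zeta> * ?r \<zeta>)"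
    and eq: "(\<integral>\<zeta>. g \<zeta> * ?r \<zeta> \<partial>P) = (\<integral>\<sigma>. g \<sigma> * indicator (cyl a k x) \<sigma> \<partial>P)"
    by (rule r)+
  have "(\<integral>\<zeta>. weight k x * g \<zeta> \<partial>P) \<le> (\<integral>\<zeta>. K * (g \<zeta> * ?r \<zeta>) \<partial>P)"
  proof (rule integral_mono_AE)
    show "AE \<zeta> in P. weight k x * g \<zeta> \<le> K * (g \<zeta> * ?r \<zeta>)"
      using ae
    proof eventually_elim
      fix \<zeta> assume "?r \<zeta> = w \<zeta>"
      then show "weight k x * g \<zeta> \<le> K * (g \<zeta> * ?r \<zeta>)"
        using mult_left_mono[OF wb(1) g01(1)[of \<zeta>], of \<zeta>] by (simp add: mult_ac)
    qed
  qed (use int int_r in auto)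
  then show "weight k x * (\<integral>\<sigma>. g \<sigma> \<partial>P) \<le> K * (\<integral>\<sigma>. g \<sigma> * indicator (cyl a k x) \<sigma> \<partial>P)"
    by (simp add: eq)
  have "(\<integral>\<zeta>. g \<zeta> * ?r \<zeta> \<partial>P) \<le> (\<integral>\<zeta>. K * weight k x * g \<zeta> \<partial>P)"
  proof (rule integral_mono_AE)
    show "AE \<zeta> in P. g \<zeta> * ?r \<zeta> \<le> K * weight k x * g \<zeta>"
      using ae
    proof eventually_elim
      fix \<zeta> assume "?r \<zeta> = w \<zeta>"
      then show "g \<zeta> * ?r \<zeta> \<le> K * weight k x * g \<zeta>"
        using mult_left_mono[OF wb(2) g01(1)[of \<zeta>], of \<zeta>] by (simp add: mult_ac)
    qed
  qed (use int int_r in auto)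
  then show "(\<integral>\<sigma>. g \<sigma> * indicator (cyl a k x) \<sigma> \<partial>P) \<le> K * weight k x * (\<integral>\<sigma>. g \<sigma> \<partial>P)"
    by (simp add: eq)
qed

lemma prob_cyl_bounds:
  assumes "1 \<le> k"
  shows "weight k x \<le> K * prob (cyl a k x)" "prob (cyl a k x) \<le> K * weight k x"
  using cyl_quasi_indep[OF assms, of "\<lambda>_. 1" a x] prob_space by auto

lemma prob_cyl_Int:
  assumes "1 \<le> k" "F \<in> sets P"
    and off: "\<And>\<sigma> \<sigma>'. (\<And>i. i \<notin> {a+1..a+k} \<Longrightarrow> \<sigma> i = \<sigma>' i) \<Longrightarrow> \<sigma> \<in> F \<longleftrightarrow> \<sigma>' \<in> F"
  shows "weight k x * prob F \<le> K * prob (F \<inter> cyl a k x)"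
    "prob (F \<inter> cyl a k x) \<le> K * weight k x * prob F"
proof -
  have eq: "indicator F \<sigma> * indicator (cyl a k x) \<sigma> = (indicator (F \<inter> cyl a k x) \<sigma> :: real)" for \<sigma>
    by (simp add: indicator_inter_arith)
  have ind: "indicator F \<sigma> = (indicator F \<sigma>' :: real)" if "\<And>i. i \<notin> {a+1..a+k} \<Longrightarrow> \<sigma> i = \<sigma>' i" for \<sigma> \<sigma>'
    using off[OF that] by (simp add: indicator_def)
  have "(indicator F :: _ \<Rightarrow> real) \<in> borel_measurable P" using assms(2) by simp
  from cyl_quasi_indep[OF assms(1) this indicator_pos_le indicator_le_1 ind, of a x]
  show "weight k x * prob F \<le> K * prob (F \<inter> cyl a k x)"
    "prob (F \<inter> cyl a k x) \<le> K * weight k x * prob F"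
    unfolding eq using assms(2) by simp_all
qed

text \<open>Whatever the first n letters are, the next one differs from that of x with conditional
  probability at least \<delta>, since the alphabet offers another letter. Every letter therefore
  costs a factor 1 - \<delta>.\<close>

lemma prob_cyl_decay:
  assumes "CARD('a) \<ge> 2"
  obtains \<rho> where "0 \<le> \<rho>" "\<rho> < 1" "\<And>n x. prob (cyl 0 (int n) x) \<le> \<rho> ^ n"
proof -
  \<comment> \<open>The least one-letter weight divided by the constant of quasi-independence; it is
    positive because the alphabet is finite.\<close>
  define \<delta> where "\<delta> = Min ((\<lambda>b. weight 1 (\<lambda>_. b) / K) ` UNIV)"
  have \<delta>: "\<delta> \<le> weight 1 (\<lambda>_. b) / K" for b unfolding \<delta>_def by (intro Min_le) auto
  have "\<delta> \<in> (\<lambda>b. weight 1 (\<lambda>_. b) / K) ` UNIV" unfolding \<delta>_def by (intro Min_in) auto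
  then have pos: "0 < \<delta>" using K_ge_1 by (auto simp: weight_pos)
  have "weight 1 (\<lambda>_. undefined) \<le> K * prob (cyl 0 1 (\<lambda>_. undefined))"
    by (intro prob_cyl_bounds) simp
  also have "\<dots> \<le> K" using K_ge_1 by (simp add: mult_left_le)
  finally have "\<delta> \<le> 1" using \<delta>[of undefined] K_ge_1
    by (intro order_trans[of \<delta> "weight 1 (\<lambda>_. undefined) / K" 1]) auto
  have "prob (cyl 0 (int n) x) \<le> (1 - \<delta>) ^ n" for n x
  proof (induction n)
    case 0
    show ?case by simp
  next
    case (Suc n)
    define F where "F = cyl 0 (int n) x"
    obtain b where b: "b \<noteq> x (int n + 1)"
    proof -
      have "\<exists>b. b \<noteq> x (int n + 1)"
      proof (rule ccontr)
        assume "\<not> ?thesis"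
        then have "(UNIV :: 'a set) = {x (int n + 1)}" by auto
        then have "CARD('a) = 1" by (metis card.empty card.insert empty_iff finite.emptyI One_nat_def)
        with assms show False by simp
      qed
      with that show ?thesis by blast
    qed
    have F[measurable]: "F \<in> sets P" unfolding F_def by (rule cyl_sets)
    have "weight 1 (\<lambda>_. b) * prob F \<le> K * prob (F \<inter> cyl (int n) 1 (\<lambda>_. b))"
    proof (rule prob_cyl_Int(1)[OF _ F])
      fix \<sigma> \<sigma>' :: "'a config"
      assume "\<And>i. i \<notin> {int n + 1..int n + 1} \<Longrightarrow> \<sigma> i = \<sigma>' i"
      then have "\<sigma> t = \<sigma>' t" if "t \<in> {1..int n}" for t using that by simp
      then show "\<sigma> \<in> F \<longleftrightarrow> \<sigma>' \<in> F" by (simp add: F_def cyl_def)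
    qed simp
    then have "weight 1 (\<lambda>_. b) / K * prob F \<le> prob (F \<inter> cyl (int n) 1 (\<lambda>_. b))"
      using K_ge_1 by (simp add: field_simps)
    moreover have "\<delta> * prob F \<le> weight 1 (\<lambda>_. b) / K * prob F"
      using \<delta> by (intro mult_right_mono) auto
    moreover have "prob (cyl 0 (int (Suc n)) x) + prob (F \<inter> cyl (int n) 1 (\<lambda>_. b)) \<le> prob F"
    proof -
      have "cyl 0 (int (Suc n)) x \<inter> (F \<inter> cyl (int n) 1 (\<lambda>_. b)) = {}"
        using b by (auto simp: cyl_def)
      then have "prob (cyl 0 (int (Suc n)) x) + prob (F \<inter> cyl (int n) 1 (\<lambda>_. b))
          = prob (cyl 0 (int (Suc n)) x \<union> (F \<inter> cyl (int n) 1 (\<lambda>_. b)))"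
        by (intro finite_measure_Union[symmetric]) auto
      also have "\<dots> \<le> prob F" by (rule finite_measure_mono[OF _ F]) (auto simp: F_def cyl_def)
      finally show ?thesis .
    qed
    ultimately have "prob (cyl 0 (int (Suc n)) x) \<le> (1 - \<delta>) * prob F" by (simp add: algebra_simps)
    also have "\<dots> \<le> (1 - \<delta>) * (1 - \<delta>) ^ n"
      using Suc \<open>\<delta> \<le> 1\<close> unfolding F_def by (intro mult_left_mono) auto
    finally show ?case by simp
  qed
  with pos \<open>\<delta> \<le> 1\<close> that[of "1 - \<delta>"] show ?thesis by simp
qed

definition rate :: real where "rate = press 1 - press 2 / 2"

text \<open>The collision probability is at most the largest weight of a word, which decays
  exponentially; with a nonpositive rate \<open>coll_bounds\<close> would keep it away from
  0.\<close>

lemma rate_pos: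
  assumes "CARD('a) \<ge> 2"
  shows "rate > 0"
proof (rule ccontr)
  assume "\<not> rate > 0"
  obtain \<rho> where \<rho>: "0 \<le> \<rho>" "\<rho> < 1" "\<And>n x. prob (cyl 0 (int n) x) \<le> \<rho> ^ n"
    using prob_cyl_decay[OF assms] by blast
  have upper: "coll (int n) \<le> K * \<rho> ^ n" if "n \<ge> 1" for n
  proof -
    have "coll (int n) \<le> (\<Sum>x\<in>Omega_on {1..int n}. K * \<rho> ^ n * weight (int n) x)"
      unfolding coll_def power2_eq_square
    proof (intro sum_mono mult_right_mono)
      fix x
      have "weight (int n) x \<le> K * prob (cyl 0 (int n) x)"
        using that by (intro prob_cyl_bounds) simp
      also have "\<dots> \<le> K * \<rho> ^ n" using K_ge_1 by (intro mult_left_mono \<rho>) simp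
      finally show "weight (int n) x \<le> K * \<rho> ^ n" .
    qed (simp add: weight_pos less_imp_le)
    then show ?thesis by (simp add: sum_distrib_left[symmetric] sum_weight)
  qed
  have "(\<lambda>n. exp (8 * bond_norm U) * (K * \<rho> ^ n)) \<longlonglongrightarrow> exp (8 * bond_norm U) * (K * 0)"
    using \<rho> by (intro tendsto_intros LIMSEQ_realpow_zero) auto
  moreover have "1 \<le> exp (8 * bond_norm U) * (K * \<rho> ^ n)" if "n \<ge> 1" for n
  proof -
    have "1 \<le> exp (- 2 * rate * real_of_int (int n))"
      using \<open>\<not> rate > 0\<close> by (simp add: mult_nonpos_nonneg)
    also have "\<dots> \<le> exp (8 * bond_norm U) * coll (int n)"
      unfolding rate_def by (rule coll_bounds) simp
    also have "\<dots> \<le> exp (8 * bond_norm U) * (K * \<rho> ^ n)"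
      using upper[OF that] by simp
    finally show ?thesis .
  qed
  then have "\<forall>\<^sub>F n in sequentially. 1 \<le> exp (8 * bond_norm U) * (K * \<rho> ^ n)"
    by (rule eventually_sequentiallyI)
  ultimately have "1 \<le> exp (8 * bond_norm U) * (K * 0)"
    using tendsto_lowerbound trivial_limit_sequentially by blast
  then show False by simp
qed

end

section \<open>Moments of the number of matches\<close>

lemma sum_exp_dist_le:
  fixes I :: "int set"
  assumes "finite I" "c > 0"
  shows "(\<Sum>j\<in>I. exp (- c * real_of_int \<bar>i - j\<bar>)) \<le> 2 / (1 - exp (- c))"
proof -
  define \<rho> where "\<rho> = exp (- c)"
  have \<rho>: "0 < \<rho>" "\<rho> < 1" using assms by (auto simp: \<rho>_def)
  have pow: "exp (- c * real_of_int \<bar>d\<bar>) = \<rho> ^ nat \<bar>d\<bar>" for d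
    unfolding \<rho>_def exp_of_nat_mult[symmetric] by (simp add: mult.commute)
  \<comment> \<open>On each side of i the distance determines the point, so the sum is part of a
    geometric series.\<close>
  have half: "(\<Sum>j\<in>J. \<rho> ^ nat \<bar>i - j\<bar>) \<le> 1 / (1 - \<rho>)"
    if "finite J" "inj_on (\<lambda>j. nat \<bar>i - j\<bar>) J" for J
  proof -
    have "(\<Sum>j\<in>J. \<rho> ^ nat \<bar>i - j\<bar>) = (\<Sum>n\<in>(\<lambda>j. nat \<bar>i - j\<bar>) ` J. \<rho> ^ n)"
      using that(2) by (simp add: sum.reindex)
    also have "\<dots> \<le> (\<Sum>n. \<rho> ^ n)"
      using \<rho> that(1) by (intro sum_le_suminf summable_geometric) auto
    also have "\<dots> = 1 / (1 - \<rho>)" using \<rho> by (intro suminf_geometric) auto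
    finally show ?thesis .
  qed
  have "(\<Sum>j\<in>I. \<rho> ^ nat \<bar>i - j\<bar>) = (\<Sum>j\<in>I \<inter> {i..}. \<rho> ^ nat \<bar>i - j\<bar>) + (\<Sum>j\<in>I - {i..}. \<rho> ^ nat \<bar>i - j\<bar>)"
    by (rule sum.Int_Diff[OF assms(1)])
  also have "\<dots> \<le> 1 / (1 - \<rho>) + 1 / (1 - \<rho>)"
    using assms(1) by (intro add_mono half) (auto simp: inj_on_def)
  finally show ?thesis unfolding pow \<rho>_def[symmetric] by simp
qed

text \<open>Nearby windows contribute a bounded amount per starting position, whereas the overlap
  saturates at k for distant ones, each of which contributes exp (- c k).\<close>

lemma sum_exp_min_dist_le:
  fixes I :: "int set"
  assumes "finite I" "c > 0"
  shows "(\<Sum>i\<in>I. \<Sum>j\<in>I. exp (- c * real_of_int (min k \<bar>i - j\<bar>)))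
    \<le> real (card I) * (2 / (1 - exp (- c)) + real (card I) * exp (- c * real_of_int k))"
proof -
  have "(\<Sum>j\<in>I. exp (- c * real_of_int (min k \<bar>i - j\<bar>)))
      \<le> 2 / (1 - exp (- c)) + real (card I) * exp (- c * real_of_int k)" for i
  proof -
    have "(\<Sum>j\<in>I. exp (- c * real_of_int (min k \<bar>i - j\<bar>)))
        \<le> (\<Sum>j\<in>I. exp (- c * real_of_int \<bar>i - j\<bar>) + exp (- c * real_of_int k))"
      by (intro sum_mono) (simp add: min_def)
    then show ?thesis using sum_exp_dist_le[OF assms, of i] by (simp add: sum.distrib)
  qed
  then have "(\<Sum>i\<in>I. \<Sum>j\<in>I. exp (- c * real_of_int (min k \<bar>i - j\<bar>)))
      \<le> (\<Sum>i\<in>I. 2 / (1 - exp (- c)) + real (card I) * exp (- c * real_of_int k))"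
    by (intro sum_mono)
  then show ?thesis by simp
qed

definition pairs :: "int set \<Rightarrow> (int \<times> int) set" where
  "pairs I = {(i, j). i \<in> I \<and> j \<in> I \<and> i \<noteq> j}"

lemma pairs_eq: "pairs I = I \<times> I - (\<lambda>i. (i, i)) ` I"
  by (auto simp: pairs_def)

lemma finite_pairs [simp]: "finite I \<Longrightarrow> finite (pairs I)"
  by (simp add: pairs_eq)

lemma card_pairs:
  assumes "finite I"
  shows "real (card (pairs I)) = real (card I) * (real (card I) - 1)"
proof -
  have "card (pairs I) = card (I \<times> I) - card ((\<lambda>i. (i, i)) ` I)"
    unfolding pairs_eq using assms by (intro card_Diff_subset) auto
  also have "card ((\<lambda>i. (i, i)) ` I) = card I" by (rule card_image) (simp add: inj_on_def)
  finally have "card (pairs I) = card I * card I - card I" by (simp add: card_cartesian_product)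
  then show ?thesis by (simp add: of_nat_diff le_square right_diff_distrib)
qed

text \<open>The set of starting positions is arbitrary: all positions for the theorem, a single
  block for part 1. Values are real because moments are taken.\<close>

definition match_count :: "int set \<Rightarrow> int \<Rightarrow> 'a config \<times> 'a config \<Rightarrow> real" where
  "match_count I k \<omega> = (\<Sum>(i, j)\<in>pairs I. indicator (match_event i j k) \<omega>)"

definition hit_event :: "int set \<Rightarrow> int \<Rightarrow> ('a config \<times> 'a config) set" where
  "hit_event I k = (\<Union>(i, j)\<in>pairs I. match_event i j k)"

context gibbs
begin

section \<open>Probabilities of one and of two matches\<close>

abbreviation PP :: "('a config \<times> 'a config) measure" where "PP \<equiv> P \<Otimes>\<^sub>M P"

sublocale pair: pair_prob_space P P ..

lemma space_PP [simp]: "space PP = UNIV"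
  by (simp add: space_pair_measure)

lemma match_event_sets [measurable]: "match_event i j k \<in> sets PP"
proof -
  have "{\<omega>\<in>space PP. \<forall>t\<in>{1..k}. \<exists>c. fst \<omega> (i + t) = c \<and> snd \<omega> (j + t) = c} \<in> sets PP"
    by measurable
  then show ?thesis by (simp add: match_event_def eq_commute)
qed

lemma hit_event_sets [measurable]: "finite I \<Longrightarrow> hit_event I k \<in> sets PP"
  unfolding hit_event_def by (intro sets.finite_UN) auto

lemma measure_PP_Times:
  "A \<in> sets P \<Longrightarrow> B \<in> sets P \<Longrightarrow> measure PP (A \<times> B) = prob A * prob B"
  by (simp add: measure_def emeasure_pair_measure_Times enn2real_mult)

lemma measure_PP_rectangles:
  assumes "finite X" "\<And>x. A x \<in> sets P" "\<And>x. B x \<in> sets P" "E \<in> sets PP"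
    and E: "\<And>\<sigma> \<eta>. (indicator E (\<sigma>, \<eta>) :: real) = (\<Sum>x\<in>X. indicator (A x) \<sigma> * indicator (B x) \<eta>)"
  shows "measure PP E = (\<Sum>x\<in>X. prob (A x) * prob (B x))"
proof -
  have "measure PP E = (\<integral>\<omega>. indicator E \<omega> \<partial>PP)"
    using assms(4) by simp
  also have "\<dots> = (\<integral>\<omega>. (\<Sum>x\<in>X. indicator (A x \<times> B x) \<omega>) \<partial>PP)"
  proof (intro Bochner_Integration.integral_cong refl)
    fix \<omega> :: "'a config \<times> 'a config"
    obtain \<sigma> \<eta> where "\<omega> = (\<sigma>, \<eta>)" by (cases \<omega>)
    then show "(indicator E \<omega> :: real) = (\<Sum>x\<in>X. indicator (A x \<times> B x) \<omega>)"
      by (simp add: E indicator_times)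
  qed
  also have "\<dots> = (\<Sum>x\<in>X. measure PP (A x \<times> B x))"
    using assms(2,3) by (subst Bochner_Integration.integral_sum) (auto simp: less_top[symmetric])
  also have "\<dots> = (\<Sum>x\<in>X. prob (A x) * prob (B x))"
    using assms(2,3) by (simp add: measure_PP_Times)
  finally show ?thesis .
qed

lemma measure_match_event:
  "measure PP (match_event i j k) = (\<Sum>x\<in>Omega_on {1..k}. prob (cyl i k x) * prob (cyl j k x))"
  by (rule measure_PP_rectangles) (auto simp: indicator_match_event)

text \<open>Once the two words are fixed, the conditions on the two configurations are independent;
  Cauchy--Schwarz acts on this product form.\<close>

lemma measure_two_matches:
  "measure PP (match_event i j k \<inter> match_event i' j' k) =
    (\<Sum>(x, y)\<in>Omega_on {1..k} \<times> Omega_on {1..k}.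
       prob (cyl i k x \<inter> cyl i' k y) * prob (cyl j k x \<inter> cyl j' k y))"
proof -
  have "measure PP (match_event i j k \<inter> match_event i' j' k) =
    (\<Sum>p\<in>Omega_on {1..k} \<times> Omega_on {1..k}.
       prob (cyl i k (fst p) \<inter> cyl i' k (snd p)) * prob (cyl j k (fst p) \<inter> cyl j' k (snd p)))"
  proof (rule measure_PP_rectangles)
    fix \<sigma> \<eta> :: "'a config"
    have "(indicator (match_event i j k \<inter> match_event i' j' k) (\<sigma>, \<eta>) :: real)
        = indicator (match_event i j k) (\<sigma>, \<eta>) * indicator (match_event i' j' k) (\<sigma>, \<eta>)"
      by (simp add: indicator_inter_arith)
    also have "\<dots> = (\<Sum>x\<in>Omega_on {1..k}. \<Sum>y\<in>Omega_on {1..k}.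
        (indicator (cyl i k x) \<sigma> * indicator (cyl j k x) \<eta>) * (indicator (cyl i' k y) \<sigma> * indicator (cyl j' k y) \<eta>))"
      unfolding indicator_match_event by (rule sum_product)
    also have "\<dots> = (\<Sum>p\<in>Omega_on {1..k} \<times> Omega_on {1..k}.
        indicator (cyl i k (fst p) \<inter> cyl i' k (snd p)) \<sigma> * indicator (cyl j k (fst p) \<inter> cyl j' k (snd p)) \<eta>)"
      unfolding sum.cartesian_product by (intro sum.cong) (auto simp: indicator_inter_arith)
    finally show "(indicator (match_event i j k \<inter> match_event i' j' k) (\<sigma>, \<eta>) :: real) =
      (\<Sum>p\<in>Omega_on {1..k} \<times> Omega_on {1..k}.
        indicator (cyl i k (fst p) \<inter> cyl i' k (snd p)) \<sigma> * indicator (cyl j k (fst p) \<inter> cyl j' k (snd p)) \<eta>)" .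
  qed auto
  then show ?thesis by (simp add: case_prod_unfold)
qed

text \<open>A factor K for each of the two configurations, and the constant of
  \<open>coll_bounds\<close>.\<close>

definition D where "D = K\<^sup>2 * exp (8 * bond_norm U)"

lemma D_ge_1: "1 \<le> D"
proof -
  have "1 * 1 \<le> D" unfolding D_def
    using K_ge_1 bond_norm_nonneg by (intro mult_mono) (auto simp: one_le_power)
  then show ?thesis by simp
qed

lemma measure_match_event_bounds:
  assumes "1 \<le> k"
  shows "measure PP (match_event i j k) \<le> D * exp (- 2 * rate * real_of_int k)"
    and "exp (- 2 * rate * real_of_int k) \<le> D * measure PP (match_event i j k)"
proof -
  note b = prob_cyl_bounds[OF assms]
  have K0: "0 \<le> K" using K_ge_1 by simp
  have "measure PP (match_event i j k) \<le> (\<Sum>x\<in>Omega_on {1..k}. (K * weight k x) * (K * weight k x))"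
    unfolding measure_match_event using K0
    by (intro sum_mono mult_mono b) (auto simp: weight_pos less_imp_le)
  also have "\<dots> = K\<^sup>2 * coll k"
    by (simp add: coll_def sum_distrib_left power2_eq_square mult_ac)
  also have "\<dots> \<le> K\<^sup>2 * (exp (8 * bond_norm U) * exp (- 2 * rate * real_of_int k))"
    unfolding rate_def using assms by (intro mult_left_mono coll_bounds) auto
  finally show "measure PP (match_event i j k) \<le> D * exp (- 2 * rate * real_of_int k)"
    by (simp add: D_def mult_ac)
  have "exp (- 2 * rate * real_of_int k) \<le> exp (8 * bond_norm U) * coll k"
    unfolding rate_def using assms by (intro coll_bounds) auto
  also have "coll k \<le> (\<Sum>x\<in>Omega_on {1..k}. (K * prob (cyl i k x)) * (K * prob (cyl j k x)))"
    unfolding coll_def power2_eq_square using K0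
    by (intro sum_mono mult_mono b) (auto simp: weight_pos less_imp_le)
  also have "\<dots> = K\<^sup>2 * measure PP (match_event i j k)"
    by (simp add: measure_match_event sum_distrib_left power2_eq_square mult_ac)
  finally show "exp (- 2 * rate * real_of_int k) \<le> D * measure PP (match_event i j k)"
    by (simp add: D_def mult_ac)
qed

text \<open>Two overlapping matches displaced by the same amount in both configurations merge into
  one match of length k + |i - i'|. For disjoint windows quasi-independence squares the bound for
  one match.\<close>

lemma measure_self_match:
  assumes "1 \<le> k"
  shows "measure PP (match_event i i k \<inter> match_event i' i' k)
    \<le> D\<^sup>2 * exp (- 2 * rate * real_of_int (k + min k \<bar>i - i'\<bar>))"
proof (cases "\<bar>i - i'\<bar> \<le> k")
  case True
  define a where "a = min i i'"
  have sub: "match_event i i k \<inter> match_event i' i' k \<subseteq> (match_event a a (k + \<bar>i - i'\<bar>) :: ('a config \<times> 'a config) set)"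
  proof
    fix \<omega> :: "'a config \<times> 'a config" assume \<omega>: "\<omega> \<in> match_event i i k \<inter> match_event i' i' k"
    have "fst \<omega> (a + t) = snd \<omega> (a + t)" if t: "t \<in> {1..k + \<bar>i - i'\<bar>}" for t
    proof -
      \<comment> \<open>As |i - i'| is at most k, the union of the two windows has no gap.\<close>
      have "a + t - i \<in> {1..k} \<or> a + t - i' \<in> {1..k}"
        using t True by (auto simp: a_def min_def split: if_splits)
      then show ?thesis
      proof
        assume "a + t - i \<in> {1..k}"
        with \<omega> have "fst \<omega> (i + (a + t - i)) = snd \<omega> (i + (a + t - i))" unfolding match_event_def by blast
        then show ?thesis by simp
      next
        assume "a + t - i' \<in> {1..k}"
        with \<omega> have "fst \<omega> (i' + (a + t - i')) = snd \<omega> (i' + (a + t - i'))" unfolding match_event_def by blast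
        then show ?thesis by simp
      qed
    qed
    then show "\<omega> \<in> match_event a a (k + \<bar>i - i'\<bar>)" unfolding match_event_def by blast
  qed
  have "measure PP (match_event i i k \<inter> match_event i' i' k) \<le> measure PP (match_event a a (k + \<bar>i - i'\<bar>))"
    by (rule pair.finite_measure_mono[OF sub]) simp
  also have "\<dots> \<le> D * exp (- 2 * rate * real_of_int (k + \<bar>i - i'\<bar>))"
    using assms by (intro measure_match_event_bounds) simp
  \<comment> \<open>Weakened to the square of D to agree with the case of disjoint windows.\<close>
  also have "\<dots> \<le> D\<^sup>2 * exp (- 2 * rate * real_of_int (k + \<bar>i - i'\<bar>))"
    using D_ge_1 by (intro mult_right_mono self_le_power) auto
  finally show ?thesis using True by (simp add: min_absorb2)
next
  case False
  have K0: "0 \<le> K" using K_ge_1 by simp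
  have b: "prob (cyl i k x \<inter> cyl i' k y) \<le> K\<^sup>2 * (weight k x * weight k y)" for x y
  proof -
    have "prob (cyl i' k y \<inter> cyl i k x) \<le> K * weight k x * prob (cyl i' k y)"
    proof (rule prob_cyl_Int(2)[OF assms cyl_sets])
      fix \<sigma> \<sigma>' :: "'a config"
      assume off: "\<And>l. l \<notin> {i + 1..i + k} \<Longrightarrow> \<sigma> l = \<sigma>' l"
      have "\<sigma> (i' + t) = \<sigma>' (i' + t)" if "t \<in> {1..k}" for t
        by (rule off) (use that False in auto)
      then show "\<sigma> \<in> cyl i' k y \<longleftrightarrow> \<sigma>' \<in> cyl i' k y" unfolding cyl_def by simp
    qed
    also have "\<dots> \<le> K * weight k x * (K * weight k y)"
      using K0 weight_pos[of k x] by (intro mult_left_mono prob_cyl_bounds assms) auto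
    finally show ?thesis by (simp add: power2_eq_square mult_ac Int_commute)
  qed
  have "measure PP (match_event i i k \<inter> match_event i' i' k)
      \<le> (\<Sum>(x, y)\<in>Omega_on {1..k} \<times> Omega_on {1..k}.
          (K\<^sup>2 * (weight k x * weight k y)) * (K\<^sup>2 * (weight k x * weight k y)))"
    unfolding measure_two_matches using K0
    by (intro sum_mono) (auto intro!: mult_mono b simp: weight_pos less_imp_le)
  also have "\<dots> = (K\<^sup>2 * coll k)\<^sup>2"
  proof -
    have "(\<Sum>(x, y)\<in>Omega_on {1..k} \<times> Omega_on {1..k}.
          (K\<^sup>2 * (weight k x * weight k y)) * (K\<^sup>2 * (weight k x * weight k y)))
        = (\<Sum>x\<in>Omega_on {1..k}. \<Sum>y\<in>Omega_on {1..k}. K ^ 4 * ((weight k x)\<^sup>2 * (weight k y)\<^sup>2))"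
      unfolding sum.cartesian_product' by (intro sum.cong refl) (simp add: power2_eq_square power4_eq_xxxx)
    also have "\<dots> = K ^ 4 * (coll k * coll k)"
      unfolding coll_def sum_product by (simp only: sum_distrib_left)
    finally show ?thesis by (simp add: power2_eq_square power4_eq_xxxx)
  qed
  also have "\<dots> \<le> (D * exp (- 2 * rate * real_of_int k))\<^sup>2"
  proof (intro power_mono)
    have "K\<^sup>2 * coll k \<le> K\<^sup>2 * (exp (8 * bond_norm U) * exp (- 2 * rate * real_of_int k))"
      unfolding rate_def using assms by (intro mult_left_mono coll_bounds) auto
    then show "K\<^sup>2 * coll k \<le> D * exp (- 2 * rate * real_of_int k)" by (simp add: D_def mult_ac)
  qed (simp add: coll_nonneg)
  also have "\<dots> = D\<^sup>2 * exp (- 2 * rate * real_of_int (k + min k \<bar>i - i'\<bar>))"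
    using False by (simp add: power_mult_distrib exp_double[symmetric] min_def algebra_simps)
  finally show ?thesis .
qed

text \<open>Cauchy--Schwarz decouples the two configurations and makes a case distinction on the
  overlap pattern of the four windows unnecessary.\<close>

lemma measure_two_matches_le:
  assumes "1 \<le> k"
  shows "measure PP (match_event i j k \<inter> match_event i' j' k)
    \<le> D\<^sup>2 * exp (- 2 * rate * real_of_int k) *
      (exp (- rate * real_of_int (min k \<bar>i - i'\<bar>)) * exp (- rate * real_of_int (min k \<bar>j - j'\<bar>)))"
proof (rule power2_le_imp_le)
  let ?X = "Omega_on {1..k} \<times> Omega_on {1..k} :: ('a config \<times> 'a config) set"
  let ?p = "\<lambda>i i' (x, y). prob (cyl i k x \<inter> cyl i' k y)"
  \<comment> \<open>Each sum of squares is again a two-match probability, now with both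
    configurations read at the same positions.\<close>
  have self: "(\<Sum>p\<in>?X. (?p i i' p)\<^sup>2) = measure PP (match_event i i k \<inter> match_event i' i' k)" for i i'
    by (simp add: measure_two_matches power2_eq_square case_prod_unfold)
  have "(measure PP (match_event i j k \<inter> match_event i' j' k))\<^sup>2 = (\<Sum>p\<in>?X. ?p i i' p * ?p j j' p)\<^sup>2"
    by (simp add: measure_two_matches case_prod_unfold)
  also have "\<dots> \<le> (\<Sum>p\<in>?X. (?p i i' p)\<^sup>2) * (\<Sum>p\<in>?X. (?p j j' p)\<^sup>2)"
    by (rule Cauchy_Schwarz_ineq_sum)
  also have "\<dots> \<le> (D\<^sup>2 * exp (- 2 * rate * real_of_int (k + min k \<bar>i - i'\<bar>)))
      * (D\<^sup>2 * exp (- 2 * rate * real_of_int (k + min k \<bar>j - j'\<bar>)))"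
    unfolding self by (intro mult_mono measure_self_match assms) auto
  also have "\<dots> = (D\<^sup>2 * exp (- 2 * rate * real_of_int k) *
      (exp (- rate * real_of_int (min k \<bar>i - i'\<bar>)) * exp (- rate * real_of_int (min k \<bar>j - j'\<bar>))))\<^sup>2"
    by (simp add: power_mult_distrib exp_double[symmetric] exp_add[symmetric] algebra_simps)
  finally show "(measure PP (match_event i j k \<inter> match_event i' j' k))\<^sup>2 \<le> \<dots>" .
qed (use D_ge_1 in simp)

section \<open>First and second moments of the count\<close>

lemma match_count_measurable [measurable]: "match_count I k \<in> borel_measurable PP"
  unfolding match_count_def by measurable

lemma match_count_nonneg: "0 \<le> match_count I k \<omega>"
  by (auto simp: match_count_def intro!: sum_nonneg)

lemma match_count_le: "finite I \<Longrightarrow> match_count I k \<omega> \<le> real (card (pairs I))"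
  unfolding match_count_def case_prod_unfold
  using sum_bounded_above[of "pairs I" "\<lambda>p. indicator (match_event (fst p) (snd p) k) \<omega> :: real" 1]
  by simp

lemma integrable_match_count: "finite I \<Longrightarrow> integrable PP (match_count I k)"
  by (intro pair.integrable_const_bound[where B = "real (card (pairs I))"] AE_I2)
    (simp_all add: match_count_le match_count_nonneg)

lemma expectation_match_count:
  assumes "finite I"
  shows "(\<integral>\<omega>. match_count I k \<omega> \<partial>PP) = (\<Sum>(i, j)\<in>pairs I. measure PP (match_event i j k))"
  unfolding match_count_def case_prod_unfold
  by (subst Bochner_Integration.integral_sum) (auto simp: less_top[symmetric])

text \<open>There are |I| (|I| - 1) ordered pairs, which is at most |I|^2, and at least half of it
  once |I| is at least 2. The mean is thus comparable to the square of |I| exp (- rate k).\<close>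

lemma expectation_match_count_bounds:
  assumes "finite I" "1 \<le> k"
  shows "(\<integral>\<omega>. match_count I k \<omega> \<partial>PP) \<le> D * (real (card I) * exp (- rate * real_of_int k))\<^sup>2"
    and "card I \<ge> 2 \<Longrightarrow> (real (card I) * exp (- rate * real_of_int k))\<^sup>2 \<le> 2 * D * (\<integral>\<omega>. match_count I k \<omega> \<partial>PP)"
proof -
  let ?q = "exp (- 2 * rate * real_of_int k)"
  have sq: "(real (card I) * exp (- rate * real_of_int k))\<^sup>2 = (real (card I))\<^sup>2 * ?q"
    by (simp add: power_mult_distrib exp_double[symmetric])
  have D0: "0 \<le> D" using D_ge_1 by simp
  have "(\<integral>\<omega>. match_count I k \<omega> \<partial>PP) \<le> (\<Sum>p\<in>pairs I. D * ?q)"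
    unfolding expectation_match_count[OF assms(1)] case_prod_unfold
    by (intro sum_mono measure_match_event_bounds assms)
  also have "\<dots> = real (card I) * (real (card I) - 1) * (D * ?q)" by (simp add: card_pairs assms)
  also have "\<dots> \<le> (real (card I))\<^sup>2 * (D * ?q)"
    using D0 by (intro mult_right_mono) (auto simp: power2_eq_square algebra_simps)
  finally show "(\<integral>\<omega>. match_count I k \<omega> \<partial>PP) \<le> D * (real (card I) * exp (- rate * real_of_int k))\<^sup>2"
    unfolding sq by (simp only: mult_ac)
  assume c: "card I \<ge> 2"
  have "(real (card I))\<^sup>2 * ?q \<le> 2 * (real (card I) * (real (card I) - 1)) * ?q"
  proof (rule mult_right_mono)
    have "real (card I) * 2 \<le> real (card I) * real (card I)" using c by (intro mult_left_mono) auto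
    then show "(real (card I))\<^sup>2 \<le> 2 * (real (card I) * (real (card I) - 1))"
      by (simp add: power2_eq_square algebra_simps)
  qed simp
  also have "\<dots> = 2 * (\<Sum>p\<in>pairs I. ?q)" by (simp add: card_pairs assms)
  also have "\<dots> \<le> 2 * (\<Sum>p\<in>pairs I. D * measure PP (match_event (fst p) (snd p) k))"
    by (intro mult_left_mono sum_mono measure_match_event_bounds assms) simp
  also have "\<dots> = 2 * D * (\<integral>\<omega>. match_count I k \<omega> \<partial>PP)"
    by (simp add: expectation_match_count[OF assms(1)] sum_distrib_left case_prod_unfold mult.assoc)
  finally show "(real (card I) * exp (- rate * real_of_int k))\<^sup>2 \<le> 2 * D * (\<integral>\<omega>. match_count I k \<omega> \<partial>PP)"
    by (simp only: sq)
qed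

lemma integrable_match_count_sq: "finite I \<Longrightarrow> integrable PP (\<lambda>\<omega>. (match_count I k \<omega>)\<^sup>2)"
  by (intro pair.integrable_const_bound[where B = "(real (card (pairs I)))\<^sup>2"] AE_I2)
    (simp_all add: power_mono match_count_le match_count_nonneg)

text \<open>\<open>measure_two_matches_le\<close> bounds each term by a factor in (i, i') times a
  factor in (j, j'), so the fourfold sum becomes the square of the double sum in
  \<open>sum_exp_min_dist_le\<close>.\<close>

lemma second_moment_match_count:
  assumes "finite I" "1 \<le> k" "rate > 0"
  defines "u \<equiv> real (card I) * exp (- rate * real_of_int k)"
  shows "(\<integral>\<omega>. (match_count I k \<omega>)\<^sup>2 \<partial>PP) \<le> D\<^sup>2 * (u * (2 / (1 - exp (- rate)) + u))\<^sup>2"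
proof -
  let ?e = "\<lambda>i i'. exp (- rate * real_of_int (min k \<bar>i - i'\<bar>))"
  let ?q = "exp (- 2 * rate * real_of_int k)"
  have "(\<integral>\<omega>. (match_count I k \<omega>)\<^sup>2 \<partial>PP) = (\<integral>\<omega>. (\<Sum>p\<in>pairs I. \<Sum>p'\<in>pairs I.
      indicator (match_event (fst p) (snd p) k \<inter> match_event (fst p') (snd p') k) \<omega>) \<partial>PP)"
    by (intro Bochner_Integration.integral_cong refl)
      (simp add: match_count_def power2_eq_square sum_product case_prod_unfold indicator_inter_arith)
  also have "\<dots> = (\<Sum>p\<in>pairs I. \<Sum>p'\<in>pairs I.
      measure PP (match_event (fst p) (snd p) k \<inter> match_event (fst p') (snd p') k))"
    by (simp add: Bochner_Integration.integral_sum less_top[symmetric])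
  also have "\<dots> \<le> (\<Sum>p\<in>pairs I. \<Sum>p'\<in>pairs I. D\<^sup>2 * ?q * (?e (fst p) (fst p') * ?e (snd p) (snd p')))"
    by (intro sum_mono measure_two_matches_le assms)
  \<comment> \<open>Adding the diagonal pairs only increases the sum and makes the index set a
    product.\<close>
  also have "\<dots> \<le> (\<Sum>p\<in>I \<times> I. \<Sum>p'\<in>I \<times> I. D\<^sup>2 * ?q * (?e (fst p) (fst p') * ?e (snd p) (snd p')))"
  proof -
    have sub: "pairs I \<subseteq> I \<times> I" by (auto simp: pairs_def)
    have "(\<Sum>p\<in>pairs I. \<Sum>p'\<in>pairs I. D\<^sup>2 * ?q * (?e (fst p) (fst p') * ?e (snd p) (snd p')))
      \<le> (\<Sum>p\<in>pairs I. \<Sum>p'\<in>I \<times> I. D\<^sup>2 * ?q * (?e (fst p) (fst p') * ?e (snd p) (snd p')))"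
      using assms(1) sub by (intro sum_mono sum_mono2) auto
    also have "\<dots> \<le> (\<Sum>p\<in>I \<times> I. \<Sum>p'\<in>I \<times> I. D\<^sup>2 * ?q * (?e (fst p) (fst p') * ?e (snd p) (snd p')))"
      using assms(1) sub by (intro sum_mono2 sum_nonneg) auto
    finally show ?thesis .
  qed
  also have "\<dots> = D\<^sup>2 * ?q * (\<Sum>i\<in>I. \<Sum>i'\<in>I. ?e i i')\<^sup>2"
  proof -
    have "(\<Sum>i\<in>I. \<Sum>i'\<in>I. ?e i i')\<^sup>2 = (\<Sum>i\<in>I. \<Sum>j\<in>I. (\<Sum>i'\<in>I. ?e i i') * (\<Sum>j'\<in>I. ?e j j'))"
      by (simp only: power2_eq_square sum_product)
    also have "\<dots> = (\<Sum>p\<in>I \<times> I. \<Sum>p'\<in>I \<times> I. ?e (fst p) (fst p') * ?e (snd p) (snd p'))"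
      by (simp only: sum.cartesian_product' sum_product fst_conv snd_conv)
    finally show ?thesis by (simp only: sum_distrib_left)
  qed
  also have "\<dots> \<le> D\<^sup>2 * ?q * (real (card I) * (2 / (1 - exp (- rate)) + u))\<^sup>2"
    unfolding u_def by (intro mult_left_mono power_mono sum_exp_min_dist_le assms sum_nonneg) auto
  also have "\<dots> = D\<^sup>2 * (u * (2 / (1 - exp (- rate)) + u))\<^sup>2"
  proof -
    have "?q = (exp (- rate * real_of_int k))\<^sup>2" by (simp add: exp_double[symmetric])
    then show ?thesis unfolding u_def by (simp add: power_mult_distrib mult_ac)
  qed
  finally show ?thesis .
qed

text \<open>The squared lower bound for the mean over the upper bound for the second moment, at u =
  v: (v^2 / (2 D))^2 / (D^2 (v (S + v))^2) with S = 2 / (1 - exp (- rate)).\<close>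

definition hit_const :: "real \<Rightarrow> real" where
  "hit_const v = (v / (2 / (1 - exp (- rate)) + v))\<^sup>2 / (4 * D ^ 4)"

lemma hit_const_pos: "rate > 0 \<Longrightarrow> v > 0 \<Longrightarrow> 0 < hit_const v"
proof -
  assume *: "rate > 0" "v > 0"
  then have "2 / (1 - exp (- rate)) > 0" by simp
  then have "2 / (1 - exp (- rate)) + v > 0" using * by linarith
  then show "0 < hit_const v" using D_ge_1 * unfolding hit_const_def by simp
qed

lemma hit_event_prob:
  assumes "finite I" "card I \<ge> 2" "1 \<le> k" "rate > 0" "v > 0"
    and v: "v \<le> real (card I) * exp (- rate * real_of_int k)"
  shows "hit_const v \<le> measure PP (hit_event I k)"
proof -
  define u where "u = real (card I) * exp (- rate * real_of_int k)"
  define S where "S = 2 / (1 - exp (- rate))"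
  define t where "t = u\<^sup>2 / (2 * D) / (D\<^sup>2 * (u * (S + u))\<^sup>2)"
  let ?N = "match_count I k"
  have u: "0 < u" using assms u_def by linarith
  have S: "0 < S" using assms by (simp add: S_def)
  have D: "0 < D" using D_ge_1 by simp
  have t: "0 \<le> t" by (simp add: t_def D less_imp_le)
  have zero: "?N \<omega> = 0" if "\<omega> \<notin> hit_event I k" for \<omega>
    using that by (auto simp: match_count_def hit_event_def intro!: sum.neutral)
  \<comment> \<open>second moment method: \<open>1 - (1 - t N)\<^sup>2\<close> is at most 1, and vanishes when \<open>N = 0\<close>; \<open>t\<close> is the optimal choice\<close>
  have pointwise: "2 * t * ?N \<omega> - t\<^sup>2 * (?N \<omega>)\<^sup>2 \<le> indicator (hit_event I k) \<omega>" for \<omega>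
  proof (cases "\<omega> \<in> hit_event I k")
    case True
    have "0 \<le> (1 - t * ?N \<omega>)\<^sup>2" by simp
    then show ?thesis using True by (simp add: power2_eq_square algebra_simps)
  qed (simp add: zero)
  have "2 * t * (u\<^sup>2 / (2 * D)) - t\<^sup>2 * (D\<^sup>2 * (u * (S + u))\<^sup>2)
      \<le> 2 * t * (\<integral>\<omega>. ?N \<omega> \<partial>PP) - t\<^sup>2 * (\<integral>\<omega>. (?N \<omega>)\<^sup>2 \<partial>PP)"
  proof (intro diff_mono mult_left_mono)
    show "u\<^sup>2 / (2 * D) \<le> (\<integral>\<omega>. ?N \<omega> \<partial>PP)"
      using expectation_match_count_bounds(2)[OF assms(1,3,2)] D by (simp add: u_def field_simps)
    show "(\<integral>\<omega>. (?N \<omega>)\<^sup>2 \<partial>PP) \<le> D\<^sup>2 * (u * (S + u))\<^sup>2"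
      unfolding u_def S_def by (intro second_moment_match_count assms)
  qed (use t in auto)
  also have "\<dots> = (\<integral>\<omega>. 2 * t * ?N \<omega> - t\<^sup>2 * (?N \<omega>)\<^sup>2 \<partial>PP)"
    using integrable_match_count[OF assms(1)] integrable_match_count_sq[OF assms(1)] by simp
  also have "\<dots> \<le> (\<integral>\<omega>. indicator (hit_event I k) \<omega> \<partial>PP)"
    using integrable_match_count[OF assms(1)] integrable_match_count_sq[OF assms(1)] assms(1)
    by (intro integral_mono pointwise) (auto simp: less_top[symmetric])
  also have "\<dots> = measure PP (hit_event I k)" using assms(1) by simp
  also have "2 * t * (u\<^sup>2 / (2 * D)) - t\<^sup>2 * (D\<^sup>2 * (u * (S + u))\<^sup>2) = (u / (S + u))\<^sup>2 / (4 * D ^ 4)"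
  proof -
    have optimum: "2 * (a / b) * a - (a / b)\<^sup>2 * b = a\<^sup>2 / b" if "b > 0" for a b :: real
      using that by (simp add: power2_eq_square field_simps)
    have quotient: "(u\<^sup>2 / (2 * D))\<^sup>2 / (D\<^sup>2 * (u * w)\<^sup>2) = (u / w)\<^sup>2 / (4 * D ^ 4)" if "w > 0" for w
      using u D that by (simp add: power2_eq_square power4_eq_xxxx field_simps)
    have "0 < D\<^sup>2 * (u * (S + u))\<^sup>2" using u S D by simp
    then show ?thesis
      unfolding t_def using u S by (simp only: optimum quotient add_pos_pos)
  qed
  finally have "(u / (S + u))\<^sup>2 / (4 * D ^ 4) \<le> measure PP (hit_event I k)" .
  \<comment> \<open>The quotient u / (S + u) increases with u, so a lower bound v for u
    suffices.\<close>
  moreover have "hit_const v \<le> (u / (S + u))\<^sup>2 / (4 * D ^ 4)"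
  proof -
    have "v * S \<le> u * S" using v S unfolding u_def by simp
    moreover have "0 < S + u" "0 < S + v" using S u assms(5) by simp_all
    ultimately have "v / (S + v) \<le> u / (S + u)" by (simp add: field_simps)
    then show ?thesis unfolding hit_const_def S_def[symmetric]
      using S assms(5) by (intro divide_right_mono power_mono) auto
  qed
  ultimately show ?thesis by linarith
qed

text \<open>The estimate for one configuration is applied to \<eta> with \<sigma> fixed and then to
  \<sigma>, each time at the cost of a factor K.\<close>

lemma pair_word_quasi_indep:
  fixes g :: "'a config \<times> 'a config \<Rightarrow> real"
  assumes l: "1 \<le> l"
    and g[measurable]: "g \<in> borel_measurable PP"
    and g01: "\<And>\<omega>. 0 \<le> g \<omega>" "\<And>\<omega>. g \<omega> \<le> 1"
    and off: "\<And>\<sigma> \<sigma>' \<eta> \<eta>'. (\<And>i. i \<notin> {a+1..a+l} \<Longrightarrow> \<sigma> i = \<sigma>' i) \<Longrightarrow>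
      (\<And>i. i \<notin> {a+1..a+l} \<Longrightarrow> \<eta> i = \<eta>' i) \<Longrightarrow> g (\<sigma>, \<eta>) = g (\<sigma>', \<eta>')"
  shows "weight l x * weight l y * (\<integral>\<omega>. g \<omega> \<partial>PP)
    \<le> K\<^sup>2 * (\<integral>\<omega>. g \<omega> * (indicator (cyl a l x) (fst \<omega>) * indicator (cyl a l y) (snd \<omega>)) \<partial>PP)"
proof -
  have K0: "0 \<le> K" using K_ge_1 by simp
  \<comment> \<open>The fibre integral again ignores the coordinates in the window, so the estimate
    applies to it a second time.\<close>
  define h where "h \<sigma> = (\<integral>\<eta>. g (\<sigma>, \<eta>) \<partial>P)" for \<sigma>
  have int: "integrable P (\<lambda>\<eta>. g (\<sigma>, \<eta>))" for \<sigma>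
    using g01 by (intro integrable_const_bound[where B = 1]) auto
  have h_meas[measurable]: "h \<in> borel_measurable P" unfolding h_def by measurable
  have h01: "0 \<le> h \<sigma>" "h \<sigma> \<le> 1" for \<sigma>
  proof -
    show "0 \<le> h \<sigma>" unfolding h_def by (intro integral_nonneg_AE) (simp add: g01)
    have "h \<sigma> \<le> (\<integral>\<eta>. 1 \<partial>P)" unfolding h_def by (intro integral_mono int g01) simp
    then show "h \<sigma> \<le> 1" using prob_space by simp
  qed
  have h_off: "h \<sigma> = h \<sigma>'" if "\<And>i. i \<notin> {a+1..a+l} \<Longrightarrow> \<sigma> i = \<sigma>' i" for \<sigma> \<sigma>'
    unfolding h_def by (intro Bochner_Integration.integral_cong refl off that)
  have g_off: "g (\<sigma>, \<eta>) = g (\<sigma>, \<eta>')" if "\<And>i. i \<notin> {a+1..a+l} \<Longrightarrow> \<eta> i = \<eta>' i" for \<sigma> \<eta> \<eta>'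
    by (rule off[OF refl that])
  have g_meas: "(\<lambda>\<eta>. g (\<sigma>, \<eta>)) \<in> borel_measurable P" for \<sigma> by measurable
  have inner: "weight l y * h \<sigma> \<le> K * (\<integral>\<eta>. g (\<sigma>, \<eta>) * indicator (cyl a l y) \<eta> \<partial>P)" for \<sigma>
    unfolding h_def by (rule cyl_quasi_indep(1)[OF l g_meas g01 g_off])
  have outer: "weight l x * (\<integral>\<sigma>. h \<sigma> \<partial>P) \<le> K * (\<integral>\<sigma>. h \<sigma> * indicator (cyl a l x) \<sigma> \<partial>P)"
    by (rule cyl_quasi_indep(1)[OF l h_meas h01 h_off])
  let ?f = "\<lambda>\<omega>. g \<omega> * (indicator (cyl a l x) (fst \<omega>) * indicator (cyl a l y) (snd \<omega>))"
  have int_g: "integrable PP g"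
    using g01 by (intro pair.integrable_const_bound[where B = 1]) auto
  have int_f: "integrable PP ?f"
    using g01 by (intro pair.integrable_const_bound[where B = 1]) (auto simp: indicator_def)
  have gh: "(\<integral>\<omega>. g \<omega> \<partial>PP) = (\<integral>\<sigma>. h \<sigma> \<partial>P)"
    unfolding h_def by (rule pair.integral_fst'[OF int_g, symmetric])
  have int_h: "integrable P (\<lambda>\<sigma>. h \<sigma> * indicator (cyl a l x) \<sigma>)"
    using h01 by (intro integrable_const_bound[where B = 1]) (auto simp: indicator_def)
  have "weight l x * weight l y * (\<integral>\<omega>. g \<omega> \<partial>PP) = weight l y * (weight l x * (\<integral>\<sigma>. h \<sigma> \<partial>P))"
    by (simp add: gh)
  also have "\<dots> \<le> weight l y * (K * (\<integral>\<sigma>. h \<sigma> * indicator (cyl a l x) \<sigma> \<partial>P))"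
    by (intro mult_left_mono outer) (simp add: weight_pos less_imp_le)
  also have "\<dots> = K * (\<integral>\<sigma>. weight l y * h \<sigma> * indicator (cyl a l x) \<sigma> \<partial>P)"
    by (simp add: mult.assoc)
  also have "\<dots> \<le> K * (\<integral>\<sigma>. K * (\<integral>\<eta>. ?f (\<sigma>, \<eta>) \<partial>P) \<partial>P)"
  proof (intro mult_left_mono K0 integral_mono)
    show "integrable P (\<lambda>\<sigma>. weight l y * h \<sigma> * indicator (cyl a l x) \<sigma>)"
      using int_h by (simp add: mult.assoc)
    show "integrable P (\<lambda>\<sigma>. K * (\<integral>\<eta>. ?f (\<sigma>, \<eta>) \<partial>P))"
      by (intro integrable_mult_right pair.integrable_fst' int_f)
    fix \<sigma>
    have "weight l y * h \<sigma> * indicator (cyl a l x) \<sigma>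
        \<le> K * (\<integral>\<eta>. g (\<sigma>, \<eta>) * indicator (cyl a l y) \<eta> \<partial>P) * indicator (cyl a l x) \<sigma>"
      by (intro mult_right_mono inner) simp
    also have "\<dots> = K * (\<integral>\<eta>. ?f (\<sigma>, \<eta>) \<partial>P)"
    proof -
      have "?f (\<sigma>, \<eta>) = indicator (cyl a l x) \<sigma> * (g (\<sigma>, \<eta>) * indicator (cyl a l y) \<eta>)" for \<eta>
        by (simp only: fst_conv snd_conv mult_ac)
      then have "(\<integral>\<eta>. ?f (\<sigma>, \<eta>) \<partial>P) = indicator (cyl a l x) \<sigma> * (\<integral>\<eta>. g (\<sigma>, \<eta>) * indicator (cyl a l y) \<eta> \<partial>P)"
        by (simp only: integral_mult_right_zero)
      then show ?thesis by (simp only: mult_ac)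
    qed
    finally show "weight l y * h \<sigma> * indicator (cyl a l x) \<sigma> \<le> K * (\<integral>\<eta>. ?f (\<sigma>, \<eta>) \<partial>P)" .
  qed
  also have "\<dots> = K\<^sup>2 * (\<integral>\<omega>. ?f \<omega> \<partial>PP)"
    unfolding integral_mult_right_zero pair.integral_fst'[OF int_f] power2_eq_square by simp
  finally show ?thesis .
qed

text \<open>An event in the window is a disjoint union of pairs of words. Bounding its probability
  by weights costs K^2, and inserting each pair of words next to g costs another K^2.\<close>

lemma pair_quasi_indep:
  fixes g :: "'a config \<times> 'a config \<Rightarrow> real"
  assumes l: "1 \<le> l"
    and g[measurable]: "g \<in> borel_measurable PP"
    and g01: "\<And>\<omega>. 0 \<le> g \<omega>" "\<And>\<omega>. g \<omega> \<le> 1"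
    and off: "\<And>\<sigma> \<sigma>' \<eta> \<eta>'. (\<And>i. i \<notin> {a+1..a+l} \<Longrightarrow> \<sigma> i = \<sigma>' i) \<Longrightarrow>
      (\<And>i. i \<notin> {a+1..a+l} \<Longrightarrow> \<eta> i = \<eta>' i) \<Longrightarrow> g (\<sigma>, \<eta>) = g (\<sigma>', \<eta>')"
    and E[measurable]: "E \<in> sets PP"
    and E_on: "\<And>\<sigma> \<sigma>' \<eta> \<eta>'. (\<And>i. i \<in> {a+1..a+l} \<Longrightarrow> \<sigma> i = \<sigma>' i) \<Longrightarrow>
      (\<And>i. i \<in> {a+1..a+l} \<Longrightarrow> \<eta> i = \<eta>' i) \<Longrightarrow> (\<sigma>, \<eta>) \<in> E \<longleftrightarrow> (\<sigma>', \<eta>') \<in> E"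
  shows "measure PP E * (\<integral>\<omega>. g \<omega> \<partial>PP) \<le> K ^ 4 * (\<integral>\<omega>. g \<omega> * indicator E \<omega> \<partial>PP)"
proof -
  let ?W = "Omega_on {1..l} :: 'a config set"
  \<comment> \<open>E evaluated at a pair of words moved into the window; by \<open>E_on\<close> the
    values outside the window are irrelevant.\<close>
  define e :: "'a config \<Rightarrow> 'a config \<Rightarrow> real" where
    "e x y = indicator E (tau (- a) x, tau (- a) y)" for x y
  have K0: "0 \<le> K" using K_ge_1 by simp
  have e0: "0 \<le> e x y" for x y by (simp add: e_def)
  have e_off: "e (restrict (tau a \<sigma>) {1..l}) (restrict (tau a \<eta>) {1..l}) = indicator E (\<sigma>, \<eta>)" for \<sigma> \<eta>
  proof -
    have "(tau (- a) (restrict (tau a \<sigma>) {1..l}), tau (- a) (restrict (tau a \<eta>) {1..l})) \<in> E \<longleftrightarrow> (\<sigma>, \<eta>) \<in> E"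
      by (rule E_on) (auto simp: tau_def)
    then show ?thesis by (simp add: e_def indicator_def)
  qed
  have ind: "indicator E \<omega> = (\<Sum>x\<in>?W. \<Sum>y\<in>?W. e x y * (indicator (cyl a l x) (fst \<omega>) * indicator (cyl a l y) (snd \<omega>)))"
    for \<omega>
  proof -
    have "(\<Sum>x\<in>?W. \<Sum>y\<in>?W. e x y * (indicator (cyl a l x) (fst \<omega>) * indicator (cyl a l y) (snd \<omega>)))
      = (\<Sum>x\<in>?W. (\<Sum>y\<in>?W. e x y * indicator (cyl a l y) (snd \<omega>)) * indicator (cyl a l x) (fst \<omega>))"
      by (unfold sum_distrib_right) (simp only: mult_ac)
    also have "\<dots> = e (restrict (tau a (fst \<omega>)) {1..l}) (restrict (tau a (snd \<omega>)) {1..l})"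
      by (simp only: sum_cyl sum_cyl[of "\<lambda>x. e x (restrict (tau a (snd \<omega>)) {1..l})"])
    finally show ?thesis by (simp add: e_off)
  qed
  \<comment> \<open>Used with f = 1 for the probability of E and with f = g for the right-hand
    side.\<close>
  have expand: "(\<integral>\<omega>. f \<omega> * indicator E \<omega> \<partial>PP) = (\<Sum>x\<in>?W. \<Sum>y\<in>?W.
      e x y * (\<integral>\<omega>. f \<omega> * (indicator (cyl a l x) (fst \<omega>) * indicator (cyl a l y) (snd \<omega>)) \<partial>PP))"
    if f[measurable]: "f \<in> borel_measurable PP" and f01: "\<And>\<omega>. 0 \<le> f \<omega>" "\<And>\<omega>. f \<omega> \<le> 1"
    for f :: "'a config \<times> 'a config \<Rightarrow> real"
  proof -
    have int: "integrable PP (\<lambda>\<omega>. f \<omega> * (indicator (cyl a l x) (fst \<omega>) * indicator (cyl a l y) (snd \<omega>)))" for x y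
      using f01 by (intro pair.integrable_const_bound[where B = 1]) (auto simp: indicator_def)
    have "(\<integral>\<omega>. f \<omega> * indicator E \<omega> \<partial>PP) = (\<integral>\<omega>. (\<Sum>x\<in>?W. \<Sum>y\<in>?W.
      e x y * (f \<omega> * (indicator (cyl a l x) (fst \<omega>) * indicator (cyl a l y) (snd \<omega>)))) \<partial>PP)"
      unfolding ind by (simp add: sum_distrib_left mult_ac)
    also have "\<dots> = (\<Sum>x\<in>?W. \<Sum>y\<in>?W.
      e x y * (\<integral>\<omega>. f \<omega> * (indicator (cyl a l x) (fst \<omega>) * indicator (cyl a l y) (snd \<omega>)) \<partial>PP))"
      using int by (simp add: Bochner_Integration.integral_sum)
    finally show ?thesis .
  qed
  have "measure PP E = (\<integral>\<omega>. 1 * indicator E \<omega> \<partial>PP)" by simp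
  also have "\<dots> = (\<Sum>x\<in>?W. \<Sum>y\<in>?W. e x y * (prob (cyl a l x) * prob (cyl a l y)))"
  proof (subst expand)
    have "(\<integral>\<omega>. 1 * (indicator (cyl a l x) (fst \<omega>) * indicator (cyl a l y) (snd \<omega>)) \<partial>PP)
        = prob (cyl a l x) * prob (cyl a l y)" for x y
    proof -
      have "(\<integral>\<omega>. 1 * (indicator (cyl a l x) (fst \<omega>) * indicator (cyl a l y) (snd \<omega>)) \<partial>PP)
          = (\<integral>\<omega>. indicator (cyl a l x \<times> cyl a l y) \<omega> \<partial>PP :: real)"
        by (intro Bochner_Integration.integral_cong refl) (auto simp: indicator_def)
      also have "\<dots> = measure PP (cyl a l x \<times> cyl a l y)" by simp
      finally show ?thesis by (simp add: measure_PP_Times)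
    qed
    then show "(\<Sum>x\<in>?W. \<Sum>y\<in>?W. e x y * (\<integral>\<omega>. 1 * (indicator (cyl a l x) (fst \<omega>) * indicator (cyl a l y) (snd \<omega>)) \<partial>PP))
      = (\<Sum>x\<in>?W. \<Sum>y\<in>?W. e x y * (prob (cyl a l x) * prob (cyl a l y)))" by simp
  qed auto
  also have "\<dots> \<le> (\<Sum>x\<in>?W. \<Sum>y\<in>?W. e x y * ((K * weight l x) * (K * weight l y)))"
    using K0 by (intro sum_mono mult_left_mono mult_mono prob_cyl_bounds l e0) (auto simp: weight_pos less_imp_le)
  finally have "measure PP E \<le> \<dots>" .
  then have "measure PP E * (\<integral>\<omega>. g \<omega> \<partial>PP)
      \<le> (\<Sum>x\<in>?W. \<Sum>y\<in>?W. e x y * ((K * weight l x) * (K * weight l y))) * (\<integral>\<omega>. g \<omega> \<partial>PP)"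
    by (rule mult_right_mono) (simp add: g01)
  also have "\<dots> = K\<^sup>2 * (\<Sum>x\<in>?W. \<Sum>y\<in>?W. e x y * (weight l x * weight l y * (\<integral>\<omega>. g \<omega> \<partial>PP)))"
    by (simp add: sum_distrib_left sum_distrib_right power2_eq_square mult_ac)
  also have "\<dots> \<le> K\<^sup>2 * (\<Sum>x\<in>?W. \<Sum>y\<in>?W. e x y *
      (K\<^sup>2 * (\<integral>\<omega>. g \<omega> * (indicator (cyl a l x) (fst \<omega>) * indicator (cyl a l y) (snd \<omega>)) \<partial>PP)))"
    by (intro mult_left_mono sum_mono e0 pair_word_quasi_indep[OF l g g01 off]) auto
  also have "\<dots> = K ^ 4 * (\<integral>\<omega>. g \<omega> * indicator E \<omega> \<partial>PP)"
    unfolding expand[OF g g01] by (simp add: sum_distrib_left power2_eq_square power4_eq_xxxx mult_ac)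
  finally show ?thesis .
qed

end

section \<open>Matches in disjoint blocks\<close>

lemma match_count_eq_card:
  "match_count I k \<omega> = real (card {p\<in>pairs I. \<omega> \<in> match_event (fst p) (snd p) k})" if "finite I"
  unfolding match_count_def case_prod_unfold
  using that by (simp add: indicator_def Int_def)

lemma N_matches_eq_match_count: "real (N_matches \<sigma> \<eta> n k) = match_count {0..int n - k} k (\<sigma>, \<eta>)"
proof -
  let ?I = "{0..int n - k}"
  have match: "restrict (tau i \<sigma>) (C_block k) = restrict (tau j \<eta>) (C_block k) \<longleftrightarrow>
      (\<sigma>, \<eta>) \<in> match_event i j k" for i j
    by (auto simp: match_event_def C_block_def tau_def fun_eq_iff restrict_def)
  have "pairs ?I = Sigma ?I (\<lambda>i. ?I - {i})" by (auto simp: pairs_def)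
  then have "match_count ?I k (\<sigma>, \<eta>) = (\<Sum>i\<in>?I. \<Sum>j\<in>?I - {i}. indicator (match_event i j k) (\<sigma>, \<eta>))"
    unfolding match_count_def by (simp add: sum.Sigma)
  then show ?thesis
    unfolding N_matches_def match by (simp add: indicator_def)
qed

lemma match_count_pos_iff: "finite I \<Longrightarrow> 0 < match_count I k \<omega> \<longleftrightarrow> \<omega> \<in> hit_event I k"
  by (auto simp: match_count_eq_card card_gt_0_iff hit_event_def)

lemma hit_event_agree:
  assumes "I \<subseteq> {a..a+l-k}"
    and "\<And>i. i \<in> {a+1..a+l} \<Longrightarrow> \<sigma> i = \<sigma>' i" "\<And>i. i \<in> {a+1..a+l} \<Longrightarrow> \<eta> i = \<eta>' i"
  shows "(\<sigma>, \<eta>) \<in> hit_event I k \<longleftrightarrow> (\<sigma>', \<eta>') \<in> hit_event I k"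
proof -
  have mem: "i + t \<in> {a+1..a+l}" if "i \<in> I" "t \<in> {1..k}" for i t
    using that assms(1) by fastforce
  have "(\<sigma>, \<eta>) \<in> match_event i j k \<longleftrightarrow> (\<sigma>', \<eta>') \<in> match_event i j k" if "i \<in> I" "j \<in> I" for i j
    unfolding match_event_def using assms(2,3) mem that by simp
  then show ?thesis unfolding hit_event_def pairs_def by blast
qed

text \<open>The last start leaves room for k letters, so a window starting in block b ends at b s +
  s at the latest. Different blocks read disjoint sets of coordinates.\<close>

definition block :: "int \<Rightarrow> int \<Rightarrow> nat \<Rightarrow> int set" where
  "block s k b = {int b * s..int b * s + s - k}"

lemma block_subset:
  assumes "b < G" "0 \<le> s" "int G * s \<le> n"
  shows "block s k b \<subseteq> {0..n - k}"
proof -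
  have "int b * s + s = (int b + 1) * s" by (simp add: algebra_simps)
  also have "\<dots> \<le> int G * s" using assms by (intro mult_right_mono) auto
  finally show ?thesis using assms by (auto simp: block_def)
qed

lemma block_disjoint:
  assumes "b < b'" "1 \<le> k"
  shows "block s k b \<inter> block s k b' = {}"
proof (cases "0 \<le> s")
  case True
  have "int b * s + s = (int b + 1) * s" by (simp add: algebra_simps)
  also have "\<dots> \<le> int b' * s" using assms True by (intro mult_right_mono) auto
  finally show ?thesis using assms by (auto simp: block_def)
next
  case False
  then show ?thesis using assms by (auto simp: block_def)
qed

text \<open>One match is chosen in each block that has one; these are distinct because their first
  positions lie in disjoint blocks.\<close>

lemma card_hit_blocks_le:
  assumes "finite I" "\<And>b. b < G \<Longrightarrow> block s k b \<subseteq> I" "1 \<le> k"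
  shows "real (card {b. b < G \<and> \<omega> \<in> hit_event (block s k b) k}) \<le> match_count I k \<omega>"
proof -
  let ?B = "{b. b < G \<and> \<omega> \<in> hit_event (block s k b) k}"
  let ?M = "{p\<in>pairs I. \<omega> \<in> match_event (fst p) (snd p) k}"
  have "\<forall>b\<in>?B. \<exists>p. p \<in> pairs (block s k b) \<and> \<omega> \<in> match_event (fst p) (snd p) k"
    by (auto simp: hit_event_def)
  from bchoice[OF this] obtain f where f: "\<And>b. b \<in> ?B \<Longrightarrow> f b \<in> pairs (block s k b) \<and> \<omega> \<in> match_event (fst (f b)) (snd (f b)) k"
    by blast
  have "inj_on f ?B"
  proof (rule inj_onI, rule ccontr)
    fix b b' assume bb': "b \<in> ?B" "b' \<in> ?B" "f b = f b'" "b \<noteq> b'"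
    then have "fst (f b) \<in> block s k b" "fst (f b) \<in> block s k b'"
      using f[OF bb'(1)] f[OF bb'(2)] by (auto simp: pairs_def)
    then show False
      using block_disjoint[of b b' k s] block_disjoint[of b' b k s] assms(3) bb'(4) by (cases "b < b'") auto
  qed
  moreover have "f ` ?B \<subseteq> ?M"
  proof (intro image_subsetI)
    fix b assume b: "b \<in> ?B"
    have "pairs (block s k b) \<subseteq> pairs I" using assms(2)[of b] b by (auto simp: pairs_def)
    with f[OF b] show "f b \<in> ?M" by blast
  qed
  moreover have "finite ?M" using assms(1) by simp
  ultimately have "card ?B \<le> card ?M" by (rule card_inj_on_le)
  then show ?thesis by (simp add: match_count_eq_card[OF assms(1)])
qed

context gibbs
begin

lemma markov_match_count:
  assumes "finite I" "t > 0"
  shows "measure PP {\<omega>. t \<le> match_count I k \<omega>} \<le> (\<integral>\<omega>. match_count I k \<omega> \<partial>PP) / t"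
proof -
  let ?A = "{\<omega>. t \<le> match_count I k \<omega>}"
  have "{\<omega>\<in>space PP. t \<le> match_count I k \<omega>} \<in> sets PP" by measurable
  then have A: "?A \<in> sets PP" by simp
  have "t * measure PP ?A = (\<integral>\<omega>. t * indicator ?A \<omega> \<partial>PP)" using A by simp
  also have "\<dots> \<le> (\<integral>\<omega>. match_count I k \<omega> \<partial>PP)"
  proof (rule integral_mono[OF _ integrable_match_count[OF assms(1)]])
    show "integrable PP (\<lambda>\<omega>. t * indicator ?A \<omega>)" using A by (simp add: less_top[symmetric])
    show "t * indicator ?A \<omega> \<le> match_count I k \<omega>" for \<omega>
      by (simp add: indicator_def match_count_nonneg)
  qed
  finally show ?thesis using assms(2) by (simp add: field_simps)
qed

text \<open>The product is 2 to the power minus the number of blocks that contain a match.\<close>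

lemma expectation_blocks_le:
  assumes c: "\<And>b. b < G \<Longrightarrow> c \<le> measure PP (hit_event (block s k b) k)" and s: "1 \<le> s"
  shows "(\<integral>\<omega>. (\<Prod>b<G. 1 - indicator (hit_event (block s k b) k) \<omega> / 2) \<partial>PP) \<le> (1 - c / (2 * K ^ 4)) ^ G"
  using c
proof (induction G)
  case 0
  show ?case using pair.prob_space by simp
next
  case (Suc G)
  let ?h = "\<lambda>b. hit_event (block s k b) k :: ('a config \<times> 'a config) set"
  define X where "X \<omega> = (\<Prod>b<G. 1 - indicator (?h b) \<omega> / 2 :: real)" for \<omega>
  have K0: "0 < K ^ 4" using K_ge_1 by simp
  have h[measurable]: "?h b \<in> sets PP" for b by (intro hit_event_sets) (simp add: block_def)
  have X[measurable]: "X \<in> borel_measurable PP" unfolding X_def by measurable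
  have X01: "0 \<le> X \<omega>" "X \<omega> \<le> 1" for \<omega>
    unfolding X_def by (auto intro!: prod_nonneg prod_le_1 simp: indicator_def)
  have IH: "(\<integral>\<omega>. X \<omega> \<partial>PP) \<le> (1 - c / (2 * K ^ 4)) ^ G"
    unfolding X_def using Suc by simp
  \<comment> \<open>The window is exactly block G, while X depends only on letters of earlier
    blocks, which lie to its left.\<close>
  have "measure PP (?h G) * (\<integral>\<omega>. X \<omega> \<partial>PP) \<le> K ^ 4 * (\<integral>\<omega>. X \<omega> * indicator (?h G) \<omega> \<partial>PP)"
  proof (rule pair_quasi_indep[where a = "int G * s" and l = s, OF s X X01 _ h])
    fix \<sigma> \<sigma>' \<eta> \<eta>' :: "'a config"
    assume off: "\<And>i. i \<notin> {int G * s + 1..int G * s + s} \<Longrightarrow> \<sigma> i = \<sigma>' i"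
      "\<And>i. i \<notin> {int G * s + 1..int G * s + s} \<Longrightarrow> \<eta> i = \<eta>' i"
    have "(\<sigma>, \<eta>) \<in> ?h b \<longleftrightarrow> (\<sigma>', \<eta>') \<in> ?h b" if "b < G" for b
    proof (rule hit_event_agree)
      show "block s k b \<subseteq> {int b * s..int b * s + s - k}" by (simp add: block_def)
      have "int b * s + s = (int b + 1) * s" by (simp add: algebra_simps)
      also have "\<dots> \<le> int G * s" using that s by (intro mult_right_mono) auto
      finally have notin: "i \<notin> {int G * s + 1..int G * s + s}" if "i \<in> {int b * s + 1..int b * s + s}" for i
        using that by auto
      show "\<sigma> i = \<sigma>' i" "\<eta> i = \<eta>' i" if "i \<in> {int b * s + 1..int b * s + s}" for i
        by (rule off, rule notin[OF that])+
    qed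
    then show "X (\<sigma>, \<eta>) = X (\<sigma>', \<eta>')" unfolding X_def indicator_def by (intro prod.cong) auto
  next
    fix \<sigma> \<sigma>' \<eta> \<eta>' :: "'a config"
    assume "\<And>i. i \<in> {int G * s + 1..int G * s + s} \<Longrightarrow> \<sigma> i = \<sigma>' i"
      "\<And>i. i \<in> {int G * s + 1..int G * s + s} \<Longrightarrow> \<eta> i = \<eta>' i"
    then show "(\<sigma>, \<eta>) \<in> ?h G \<longleftrightarrow> (\<sigma>', \<eta>') \<in> ?h G"
      by (intro hit_event_agree[where a = "int G * s" and l = s]) (simp_all add: block_def)
  qed
  moreover have "c * (\<integral>\<omega>. X \<omega> \<partial>PP) \<le> measure PP (?h G) * (\<integral>\<omega>. X \<omega> \<partial>PP)"
    using Suc.prems[of G] X01 by (intro mult_right_mono integral_nonneg_AE) auto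
  ultimately have "c * (\<integral>\<omega>. X \<omega> \<partial>PP) \<le> K ^ 4 * (\<integral>\<omega>. X \<omega> * indicator (?h G) \<omega> \<partial>PP)" by linarith
  then have low: "c / K ^ 4 * (\<integral>\<omega>. X \<omega> \<partial>PP) \<le> (\<integral>\<omega>. X \<omega> * indicator (?h G) \<omega> \<partial>PP)"
    using K0 by (simp add: field_simps)
  have int: "integrable PP X" "integrable PP (\<lambda>\<omega>. X \<omega> * indicator (?h G) \<omega>)"
    by (intro pair.integrable_const_bound[where B = 1] AE_I2; simp add: X01 indicator_def)+
  \<comment> \<open>The new factor removes half of the integral of X over the event, hence at least
    the proportion c / (2 K^4) by \<open>low\<close>.\<close>
  have "(\<integral>\<omega>. (\<Prod>b<Suc G. 1 - indicator (?h b) \<omega> / 2) \<partial>PP) = (\<integral>\<omega>. X \<omega> - X \<omega> * indicator (?h G) \<omega> / 2 \<partial>PP)"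
    by (simp add: X_def algebra_simps)
  also have "\<dots> = (\<integral>\<omega>. X \<omega> \<partial>PP) - (\<integral>\<omega>. X \<omega> * indicator (?h G) \<omega> \<partial>PP) / 2"
    using int by simp
  also have "\<dots> \<le> (1 - c / (2 * K ^ 4)) * (\<integral>\<omega>. X \<omega> \<partial>PP)"
    using low by (simp add: algebra_simps)
  also have "\<dots> \<le> (1 - c / (2 * K ^ 4)) * (1 - c / (2 * K ^ 4)) ^ G"
  proof (intro mult_left_mono IH)
    have "c \<le> 1" using Suc.prems[of G] pair.prob_le_1[of "?h G"] by linarith
    moreover have "1 \<le> K ^ 4" using K_ge_1 by simp
    ultimately show "0 \<le> 1 - c / (2 * K ^ 4)" using K0 by (simp add: field_simps)
  qed
  finally show ?case by simp
qed

text \<open>With at most m matches at most m blocks are hit, so the product X is at least 2^(-m).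
  Bounding the indicator by 2^m X avoids a sum over the possible sets of hit blocks.\<close>

lemma measure_few_matches_le:
  assumes "1 \<le> k" "1 \<le> s" "int G * s \<le> n"
    and c: "\<And>b. b < G \<Longrightarrow> c \<le> measure PP (hit_event (block s k b) k)"
  shows "measure PP {\<omega>. match_count {0..n - k} k \<omega> \<le> real m} \<le> 2 ^ m * (1 - c / (2 * K ^ 4)) ^ G"
proof -
  let ?h = "\<lambda>b. hit_event (block s k b) k :: ('a config \<times> 'a config) set"
  let ?A = "{\<omega>. match_count {0..n - k} k \<omega> \<le> real m}"
  define X where "X \<omega> = (\<Prod>b<G. 1 - indicator (?h b) \<omega> / 2 :: real)" for \<omega>
  have h[measurable]: "?h b \<in> sets PP" for b by (intro hit_event_sets) (simp add: block_def)
  have X[measurable]: "X \<in> borel_measurable PP" unfolding X_def by measurable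
  have X01: "0 \<le> X \<omega>" "X \<omega> \<le> 1" for \<omega>
    unfolding X_def by (auto intro!: prod_nonneg prod_le_1 simp: indicator_def)
  have int: "integrable PP X"
    by (intro pair.integrable_const_bound[where B = 1] AE_I2; simp add: X01)
  have "{\<omega>\<in>space PP. match_count {0..n - k} k \<omega> \<le> real m} \<in> sets PP" by measurable
  then have A: "?A \<in> sets PP" by simp
  have pointwise: "indicator ?A \<omega> \<le> 2 ^ m * X \<omega>" for \<omega>
  proof (cases "\<omega> \<in> ?A")
    case True
    let ?B = "{b. b < G \<and> \<omega> \<in> ?h b}"
    have "real (card ?B) \<le> match_count {0..n - k} k \<omega>"
      using assms by (intro card_hit_blocks_le block_subset[of _ G]) auto
    with True have card: "card ?B \<le> m" by simp
    have "X \<omega> = (\<Prod>b<G. if \<omega> \<in> ?h b then 1 / 2 else 1)"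
      unfolding X_def by (intro prod.cong) (auto simp: indicator_def)
    also have "\<dots> = (\<Prod>b\<in>{b\<in>{..<G}. \<omega> \<in> ?h b}. 1 / 2)"
      by (rule prod.inter_filter[symmetric]) simp
    also have "\<dots> = (1 / 2) ^ card ?B" by simp
    finally have "X \<omega> \<ge> (1 / 2) ^ m" using card by (simp add: power_decreasing)
    then have "2 ^ m * (1 / 2) ^ m \<le> 2 ^ m * X \<omega>" by (intro mult_left_mono) auto
    then show ?thesis using True by (simp add: power_mult_distrib[symmetric])
  qed (simp add: X01)
  have "measure PP ?A = (\<integral>\<omega>. indicator ?A \<omega> \<partial>PP)" using A by simp
  also have "\<dots> \<le> (\<integral>\<omega>. 2 ^ m * X \<omega> \<partial>PP)"
    using A int by (intro integral_mono pointwise) (auto simp: less_top[symmetric])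
  also have "\<dots> = 2 ^ m * (\<integral>\<omega>. X \<omega> \<partial>PP)" by simp
  also have "\<dots> \<le> 2 ^ m * (1 - c / (2 * K ^ 4)) ^ G"
    unfolding X_def using c assms(2) by (intro mult_left_mono expectation_blocks_le) auto
  finally show ?thesis .
qed

end

section \<open>The three regimes\<close>

locale matching = gibbs U P for U :: "int set \<Rightarrow> 'a::finite config \<Rightarrow> real" and P +
  fixes kstar :: "nat \<Rightarrow> real" and k :: "nat \<Rightarrow> int"
  assumes card_alphabet: "CARD('a) \<ge> 2"
    and kstar: "\<And>n. kstar n = ln (real n) / rate"
    and k_range: "\<forall>\<^sub>F n in sequentially. 1 \<le> k n \<and> k n < int n"
begin

abbreviation "starts n \<equiv> {0..int n - k n}"

abbreviation "mean n \<equiv> (\<integral>\<omega>. match_count (starts n) (k n) \<omega> \<partial>PP)"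

lemma rate0: "rate > 0"
  by (rule rate_pos[OF card_alphabet])

text \<open>\<open>kstar\<close> is defined so that exp (rate * kstar n) = n; only the deviation
  from \<open>kstar\<close> then remains in the estimates.\<close>

lemma exp_rate_kstar: "n \<ge> 1 \<Longrightarrow> exp (- rate * x) * real n = exp (- rate * (x - kstar n))"
proof -
  assume "n \<ge> 1"
  have "- rate * (x - kstar n) = - rate * x + ln (real n)"
    using rate0 by (simp add: kstar right_diff_distrib)
  then show ?thesis using \<open>n \<ge> 1\<close> by (simp only: exp_add) simp
qed

lemma mean_nonneg: "0 \<le> mean n"
  by (intro integral_nonneg_AE) (simp add: match_count_nonneg)

lemma eventually_mean_le:
  "\<forall>\<^sub>F n in sequentially. mean n \<le> D * exp (- 2 * rate * (real_of_int (k n) - kstar n))"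
  using k_range
proof eventually_elim
  fix n assume n: "1 \<le> k n \<and> k n < int n"
  have "mean n \<le> D * (real (card (starts n)) * exp (- rate * real_of_int (k n)))\<^sup>2"
    using n by (intro expectation_match_count_bounds) auto
  also have "\<dots> \<le> D * (real n * exp (- rate * real_of_int (k n)))\<^sup>2"
    using n D_ge_1 by (intro mult_left_mono power_mono mult_right_mono) auto
  also have "real n * exp (- rate * real_of_int (k n)) = exp (- rate * (real_of_int (k n) - kstar n))"
  proof -
    have "1 \<le> n" using n by linarith
    from exp_rate_kstar[OF this, of "real_of_int (k n)"] show ?thesis by (simp only: mult.commute)
  qed
  also have "\<dots>\<^sup>2 = exp (- 2 * rate * (real_of_int (k n) - kstar n))"
    by (simp add: exp_double[symmetric] mult.assoc)
  finally show "mean n \<le> D * exp (- 2 * rate * (real_of_int (k n) - kstar n))" .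
qed

text \<open>Since \<open>kstar\<close> grows logarithmically, windows of about this length occupy a
  negligible part of the interval, or of each of a fixed number of blocks, and enough starting
  positions remain.\<close>

lemma eventually_kstar_small:
  fixes \<epsilon> B :: real
  assumes "\<epsilon> > 0"
  shows "\<forall>\<^sub>F n in sequentially. kstar n + B \<le> \<epsilon> * real n"
proof -
  have "\<forall>\<^sub>F n in sequentially. ln (real n) / real n < rate * (\<epsilon> / 2)"
    using lim_ln_over_n rate0 assms by (intro order_tendstoD) auto
  moreover have "\<forall>\<^sub>F n in sequentially. 2 * B / \<epsilon> \<le> real n"
    using filterlim_real_sequentially by (auto simp: filterlim_at_top)
  moreover have "\<forall>\<^sub>F n in sequentially. 0 < n" by (rule eventually_gt_at_top)
  ultimately show ?thesis
  proof eventually_elim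
    fix n assume n: "ln (real n) / real n < rate * (\<epsilon> / 2)" "2 * B / \<epsilon> \<le> real n" "0 < n"
    have "kstar n \<le> \<epsilon> / 2 * real n" using n rate0 by (simp add: kstar field_simps)
    moreover have "B \<le> \<epsilon> / 2 * real n" using n assms by (simp add: field_simps)
    ultimately show "kstar n + B \<le> \<epsilon> * real n" by (simp add: field_simps)
  qed
qed

text \<open>The number G of blocks is fixed first, from m and the desired accuracy, and n tends to
  infinity afterwards. This works because the bound \<open>hit_const 1\<close> for a match in a
  block does not depend on G: the growing distance from \<open>kstar\<close> compensates for the
  shorter blocks.\<close>

lemma many_matches:
  assumes "filterlim (\<lambda>n. kstar n - real_of_int (k n)) at_top sequentially"
  shows "(\<lambda>n. measure PP {\<omega>. match_count (starts n) (k n) \<omega> \<le> real m}) \<longlonglongrightarrow> 0"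
proof (rule order_tendstoI)
  fix a :: real assume "a < 0"
  then show "\<forall>\<^sub>F n in sequentially. a < measure PP {\<omega>. match_count (starts n) (k n) \<omega> \<le> real m}"
    by (intro always_eventually allI less_le_trans[OF \<open>a < 0\<close>]) simp
next
  fix a :: real assume a: "0 < a"
  define c where "c = hit_const 1 / (2 * K ^ 4)"
  have K4: "K ^ 4 > 0" using K_ge_1 by simp
  have c: "0 < c" using hit_const_pos[OF rate0, of 1] K4 by (simp add: c_def)
  \<comment> \<open>The maximum with 0 keeps the base nonnegative; that c is at most 1 is seen only
    later, once \<open>hit_const 1\<close> is known to bound a probability from below.\<close>
  have "(\<lambda>G. 2 ^ m * max (1 - c) 0 ^ G) \<longlonglongrightarrow> 2 ^ m * 0"
    using c by (intro tendsto_intros LIMSEQ_realpow_zero) auto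
  then have "\<forall>\<^sub>F G in sequentially. 2 ^ m * max (1 - c) 0 ^ G < a"
    using a by (intro order_tendstoD) auto
  then obtain G0 where "\<And>G. G \<ge> G0 \<Longrightarrow> 2 ^ m * max (1 - c) 0 ^ G < a"
    by (auto simp: eventually_sequentially)
  then obtain G where G: "1 \<le> G" "2 ^ m * max (1 - c) 0 ^ G < a"
    using max.cobounded1 max.cobounded2 by metis
  \<comment> \<open>A block has length about n / G = 2 \<epsilon> n: half of it is reserved for the
    window and half supplies starting positions.\<close>
  define \<epsilon> where "\<epsilon> = 1 / (2 * real G)"
  have \<epsilon>: "\<epsilon> > 0" using G by (simp add: \<epsilon>_def)
  \<comment> \<open>This margin makes \<epsilon> n exp (- rate k) at least 2 G \<epsilon> = 1, the
    argument of \<open>hit_const\<close>.\<close>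
  have "\<forall>\<^sub>F n in sequentially. ln (2 * real G) / rate \<le> kstar n - real_of_int (k n)"
    using assms by (simp add: filterlim_at_top)
  \<comment> \<open>Of the summand 2, one unit pays for the rounding in \<open>n div G\<close> and
    one ensures two starting positions in each block.\<close>
  with k_range eventually_kstar_small[OF \<epsilon>, of 2]
  show "\<forall>\<^sub>F n in sequentially. measure PP {\<omega>. match_count (starts n) (k n) \<omega> \<le> real m} < a"
  proof eventually_elim
    fix n assume n: "1 \<le> k n \<and> k n < int n" "kstar n + 2 \<le> \<epsilon> * real n"
      "ln (2 * real G) / rate \<le> kstar n - real_of_int (k n)"
    have n1: "1 \<le> n" using n(1) by linarith
    define s where "s = int (n div G)"
    have ln_G: "0 \<le> ln (2 * real G)" using G by simp
    have "real_of_int (k n) \<le> kstar n - ln (2 * real G) / rate" using n(3) by linarith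
    also have "\<dots> \<le> kstar n" using ln_G rate0 by simp
    finally have k_small: "real_of_int (k n) + 2 \<le> \<epsilon> * real n" using n(2) by linarith
    have "real n / real G - 1 < real_of_int s"
    proof -
      have "n < (n div G + 1) * G" using G dividend_less_times_div[of G n] by (simp add: algebra_simps)
      then have "real n < (real (n div G) + 1) * real G"
        by (metis of_nat_1 of_nat_add of_nat_less_iff of_nat_mult)
      then show ?thesis using G by (simp add: s_def field_simps)
    qed
    moreover have "real n / real G = 2 * (\<epsilon> * real n)" by (simp add: \<epsilon>_def)
    ultimately have s: "\<epsilon> * real n + 1 \<le> real_of_int (s - k n)" using k_small by simp
    have \<epsilon>n: "0 \<le> \<epsilon> * real n" using \<epsilon> by simp
    then have sk: "1 \<le> s - k n" using s by linarith
    have "G * (n div G) \<le> n" by simp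
    then have Gs: "int G * s \<le> int n" unfolding s_def by (metis of_nat_le_iff of_nat_mult)
    have hit: "hit_const 1 \<le> measure PP (hit_event (block s (k n) b) (k n))" for b
    proof (rule hit_event_prob)
      have card: "card (block s (k n) b) = nat (s - k n + 1)" by (simp add: block_def)
      then show "2 \<le> card (block s (k n) b)" using sk by simp
      have "\<epsilon> * real n \<le> real (card (block s (k n) b))" using s sk by (simp add: card)
      then have "\<epsilon> * real n * exp (- rate * real_of_int (k n))
          \<le> real (card (block s (k n) b)) * exp (- rate * real_of_int (k n))"
        by (rule mult_right_mono) simp
      moreover have "1 \<le> \<epsilon> * real n * exp (- rate * real_of_int (k n))"
      proof -
        have "ln (2 * real G) \<le> - rate * (real_of_int (k n) - kstar n)"
          using n(3) rate0 by (simp add: field_simps)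
        then have "exp (ln (2 * real G)) \<le> exp (- rate * (real_of_int (k n) - kstar n))"
          by (simp only: exp_le_cancel_iff)
        then have "2 * real G \<le> exp (- rate * real_of_int (k n)) * real n"
          unfolding exp_rate_kstar[OF n1, symmetric] using G by simp
        then have "\<epsilon> * (2 * real G) \<le> \<epsilon> * (exp (- rate * real_of_int (k n)) * real n)"
          using \<epsilon> by (intro mult_left_mono) auto
        then show ?thesis using G by (simp add: \<epsilon>_def mult_ac)
      qed
      ultimately show "1 \<le> real (card (block s (k n) b)) * exp (- rate * real_of_int (k n))"
        by linarith
    qed (use n rate0 in \<open>auto simp: block_def\<close>)
    have "measure PP {\<omega>. match_count (starts n) (k n) \<omega> \<le> real m} \<le> 2 ^ m * (1 - c) ^ G"
      unfolding c_def using n sk by (intro measure_few_matches_le[of _ s] hit Gs) auto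
    also have "\<dots> \<le> 2 ^ m * max (1 - c) 0 ^ G"
    proof -
      have "c \<le> 1"
      proof -
        have "hit_const 1 \<le> 1" using hit[of 0] pair.prob_le_1 order_trans by blast
        moreover have "1 \<le> K ^ 4" using K_ge_1 by simp
        ultimately show ?thesis unfolding c_def by (simp add: divide_le_eq)
      qed
      then show ?thesis by simp
    qed
    finally show "measure PP {\<omega>. match_count (starts n) (k n) \<omega> \<le> real m} < a" using G by linarith
  qed
qed

lemma few_matches:
  assumes "filterlim (\<lambda>n. real_of_int (k n) - kstar n) at_top sequentially" "m > 0"
  shows "(\<lambda>n. measure PP {\<omega>. real m \<le> match_count (starts n) (k n) \<omega>}) \<longlonglongrightarrow> 0"
proof (rule tendsto_sandwich[OF _ _ tendsto_const])
  show "\<forall>\<^sub>F n in sequentially. measure PP {\<omega>. real m \<le> match_count (starts n) (k n) \<omega>}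
      \<le> D * exp (- 2 * rate * (real_of_int (k n) - kstar n))"
    using eventually_mean_le
  proof eventually_elim
    fix n assume n: "mean n \<le> D * exp (- 2 * rate * (real_of_int (k n) - kstar n))"
    have "measure PP {\<omega>. real m \<le> match_count (starts n) (k n) \<omega>} \<le> mean n / real m"
      using assms(2) by (intro markov_match_count) auto
    also have "\<dots> \<le> mean n / 1" using assms(2) by (intro divide_left_mono mean_nonneg) auto
    finally show "measure PP {\<omega>. real m \<le> match_count (starts n) (k n) \<omega>}
        \<le> D * exp (- 2 * rate * (real_of_int (k n) - kstar n))" using n by simp
  qed
  have "filterlim (\<lambda>n. - 2 * rate * (real_of_int (k n) - kstar n)) at_bot sequentially"
    using rate0 by (intro filterlim_tendsto_neg_mult_at_bot[OF tendsto_const _ assms(1)]) simp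
  from filterlim_compose[OF exp_at_bot this]
  have "(\<lambda>n. D * exp (- 2 * rate * (real_of_int (k n) - kstar n))) \<longlonglongrightarrow> D * 0"
    by (intro tendsto_intros)
  then show "(\<lambda>n. D * exp (- 2 * rate * (real_of_int (k n) - kstar n))) \<longlonglongrightarrow> 0" by simp
qed simp

section \<open>The critical window: bounded mean and a match with positive probability\<close>

lemma critical_mean_bounded:
  assumes "bounded (range (\<lambda>n. real_of_int (k n) - kstar n))"
  obtains C where "C > 0" "\<And>n. mean n \<le> C"
proof -
  obtain B where B: "\<And>n. \<bar>real_of_int (k n) - kstar n\<bar> \<le> B"
    using assms by (auto simp: bounded_iff)
  have "\<forall>\<^sub>F n in sequentially. mean n \<le> D * exp (2 * rate * B)"
    using eventually_mean_le
  proof eventually_elim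
    fix n assume n: "mean n \<le> D * exp (- 2 * rate * (real_of_int (k n) - kstar n))"
    have "- (real_of_int (k n) - kstar n) \<le> B" using B[of n] by linarith
    then have "2 * rate * - (real_of_int (k n) - kstar n) \<le> 2 * rate * B"
      using rate0 by (intro mult_left_mono) auto
    then have "- 2 * rate * (real_of_int (k n) - kstar n) \<le> 2 * rate * B"
      by (simp only: mult_minus_left mult_minus_right)
    then have "exp (- 2 * rate * (real_of_int (k n) - kstar n)) \<le> exp (2 * rate * B)"
      by (simp only: exp_le_cancel_iff)
    moreover have "0 \<le> D" using D_ge_1 by simp
    ultimately have "D * exp (- 2 * rate * (real_of_int (k n) - kstar n)) \<le> D * exp (2 * rate * B)"
      by (rule mult_left_mono)
    with n show "mean n \<le> D * exp (2 * rate * B)" by linarith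
  qed
  then obtain n0 where n0: "\<And>n. n \<ge> n0 \<Longrightarrow> mean n \<le> D * exp (2 * rate * B)"
    by (auto simp: eventually_sequentially)
  \<comment> \<open>Tightness concerns every n, so the finitely many means before the estimate takes
    effect are added to the constant.\<close>
  define C where "C = D * exp (2 * rate * B) + (\<Sum>n<n0. mean n)"
  have pos: "0 < D * exp (2 * rate * B)" using D_ge_1 by simp
  have sum0: "0 \<le> (\<Sum>n<n0. mean n)" by (intro sum_nonneg mean_nonneg)
  have "mean n \<le> C" for n
  proof (cases "n < n0")
    case True
    then have "mean n \<le> (\<Sum>n<n0. mean n)" using mean_nonneg by (intro member_le_sum) auto
    then show ?thesis using pos by (simp add: C_def)
  next
    case False
    then show ?thesis using n0[of n] sum0 by (simp add: C_def)
  qed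
  moreover have "C > 0" using pos sum0 by (simp add: C_def)
  ultimately show ?thesis using that by blast
qed

lemma critical_hit:
  assumes "bounded (range (\<lambda>n. real_of_int (k n) - kstar n))"
  obtains c where "c > 0"
    "\<forall>\<^sub>F n in sequentially. c \<le> measure PP {\<omega>. 0 < match_count (starts n) (k n) \<omega>}"
proof -
  obtain B where B: "\<And>n. \<bar>real_of_int (k n) - kstar n\<bar> \<le> B"
    using assms by (auto simp: bounded_iff)
  \<comment> \<open>exp (- rate * B) is the worst case of the bounded deviation; the division by 2
    reflects that only n / 2 starting positions are guaranteed.\<close>
  define v where "v = exp (- rate * B) / 2"
  have small: "\<forall>\<^sub>F n in sequentially. kstar n + B \<le> real n / 2"
    using eventually_kstar_small[of "1 / 2" B] by simp
  have "\<forall>\<^sub>F n in sequentially. hit_const v \<le> measure PP {\<omega>. 0 < match_count (starts n) (k n) \<omega>}"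
    using k_range small
  proof eventually_elim
    fix n assume n: "1 \<le> k n \<and> k n < int n" "kstar n + B \<le> real n / 2"
    have n1: "1 \<le> n" using n(1) by linarith
    have card: "real (card (starts n)) = real n - real_of_int (k n) + 1" using n by simp
    have "real_of_int (k n) \<le> real n / 2" using B[of n] n(2) by linarith
    then have "1 / 2 * real n \<le> real (card (starts n))" using card by linarith
    then have "1 / 2 * real n * exp (- rate * real_of_int (k n))
        \<le> real (card (starts n)) * exp (- rate * real_of_int (k n))"
      by (rule mult_right_mono) simp
    moreover have "v \<le> 1 / 2 * real n * exp (- rate * real_of_int (k n))"
    proof -
      have "- rate * B \<le> - rate * (real_of_int (k n) - kstar n)"
        using B[of n] rate0 by (auto simp: abs_le_iff)
      then have "exp (- rate * B) \<le> exp (- rate * real_of_int (k n)) * real n"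
        unfolding exp_rate_kstar[OF n1] by (simp only: exp_le_cancel_iff)
      then show ?thesis by (simp add: v_def mult.commute)
    qed
    ultimately have "v \<le> real (card (starts n)) * exp (- rate * real_of_int (k n))" by linarith
    then have "hit_const v \<le> measure PP (hit_event (starts n) (k n))"
      using n rate0 by (intro hit_event_prob) (auto simp: v_def)
    also have "(hit_event (starts n) (k n) :: ('a config \<times> 'a config) set) = {\<omega>. 0 < match_count (starts n) (k n) \<omega>}"
      by (auto simp: match_count_pos_iff)
    finally show "hit_const v \<le> measure PP {\<omega>. 0 < match_count (starts n) (k n) \<omega>}" .
  qed
  then show ?thesis using that[of "hit_const v"] hit_const_pos[OF rate0, of v] by (simp add: v_def)
qed

section \<open>Tightness and failure of convergence to zero\<close>

abbreviation "law n \<equiv> distr PP borel (match_count (starts n) (k n))"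

lemma real_distribution_law: "real_distribution (law n)"
  by (intro pair.real_distribution_distr) measurable

lemma measure_law_atMost: "measure (law n) {..x} = measure PP {\<omega>. match_count (starts n) (k n) \<omega> \<le> x}"
  by (simp add: measure_distr vimage_def)

lemma critical_tight:
  assumes "bounded (range (\<lambda>n. real_of_int (k n) - kstar n))"
  shows "tight law"
  unfolding tight_def
proof (intro conjI allI impI real_distribution_law)
  fix \<epsilon> :: real assume \<epsilon>: "\<epsilon> > 0"
  obtain C where C: "C > 0" "\<And>n. mean n \<le> C" using critical_mean_bounded[OF assms] by blast
  \<comment> \<open>Markov's inequality leaves mass at most \<epsilon> / 2 at or above b.\<close>
  define b where "b = 2 * C / \<epsilon>"
  have b: "0 < b" using C \<epsilon> by (simp add: b_def)
  \<comment> \<open>The interval is open on the left and has to contain the value 0, hence the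
    endpoint -1.\<close>
  have "1 - \<epsilon> < measure (law n) {-1<..b}" for n
  proof -
    interpret law: real_distribution "law n" by (rule real_distribution_law)
    have "{\<omega>\<in>space PP. b \<le> match_count (starts n) (k n) \<omega>} \<in> sets PP" by measurable
    then have A: "{\<omega>. b \<le> match_count (starts n) (k n) \<omega>} \<in> sets PP" by simp
    have "measure PP {\<omega>. b \<le> match_count (starts n) (k n) \<omega>} \<le> mean n / b"
      using b by (intro markov_match_count) auto
    also have "\<dots> \<le> C / b" using C b by (intro divide_right_mono) auto
    also have "\<dots> < \<epsilon>" using C \<epsilon> by (simp add: b_def)
    finally have "1 - \<epsilon> < 1 - measure PP {\<omega>. b \<le> match_count (starts n) (k n) \<omega>}" by simp
    also have "\<dots> = measure PP (UNIV - {\<omega>. b \<le> match_count (starts n) (k n) \<omega>})"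
      using pair.prob_compl[OF A] by simp
    also have "\<dots> \<le> measure PP (match_count (starts n) (k n) -` {-1<..b} \<inter> space PP)"
    proof (rule pair.finite_measure_mono)
      show "UNIV - {\<omega>. b \<le> match_count (starts n) (k n) \<omega>} \<subseteq> match_count (starts n) (k n) -` {-1<..b} \<inter> space PP"
      proof -
        have "- 1 < match_count (starts n) (k n) \<omega>" for \<omega> :: "'a config \<times> 'a config"
          by (rule less_le_trans[OF _ match_count_nonneg]) simp
        then show ?thesis by auto
      qed
      show "match_count (starts n) (k n) -` {-1<..b} \<inter> space PP \<in> sets PP" by measurable
    qed
    also have "\<dots> = measure (law n) {-1<..b}" by (simp add: measure_distr)
    finally show ?thesis .
  qed
  then show "\<exists>a b. a < b \<and> (\<forall>n. 1 - \<epsilon> < measure (law n) {a<..b})"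
    using b by (intro exI[of _ "-1"] exI[of _ b]) auto
qed

text \<open>The limiting distribution function is continuous at 1/2, and an integer count is at most
  1/2 only if it vanishes. Convergence would force the probability of no match to tend to 1, against
  \<open>critical_hit\<close>.\<close>

lemma critical_not_weak_conv:
  assumes "bounded (range (\<lambda>n. real_of_int (k n) - kstar n))"
  shows "\<not> weak_conv_m law (return borel 0)"
proof
  assume conv: "weak_conv_m law (return borel 0)"
  obtain c where c: "c > 0"
    "\<forall>\<^sub>F n in sequentially. c \<le> measure PP {\<omega>. 0 < match_count (starts n) (k n) \<omega>}"
    using critical_hit[OF assms] by blast
  have cdf: "cdf (return borel 0) x = indicator {0..} x" for x :: real
    by (simp add: cdf_def measure_return indicator_def)
  have "isCont (cdf (return borel (0::real))) (1 / 2)"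
  proof -
    have "\<forall>\<^sub>F x in nhds (1 / 2 :: real). cdf (return borel (0::real)) x = 1"
      using eventually_nhds_in_open[of "{0<..}" "1 / 2 :: real"]
      by (auto elim!: eventually_mono simp: cdf)
    then have "isCont (cdf (return borel (0::real))) (1 / 2) \<longleftrightarrow> isCont (\<lambda>_. 1 :: real) (1 / 2 :: real)"
      by (rule isCont_cong)
    then show ?thesis by simp
  qed
  with conv have "(\<lambda>n. cdf (law n) (1 / 2)) \<longlonglongrightarrow> cdf (return borel 0) (1 / 2)"
    unfolding weak_conv_m_def weak_conv_def by blast
  then have lim: "(\<lambda>n. measure PP {\<omega>. match_count (starts n) (k n) \<omega> \<le> 1 / 2}) \<longlonglongrightarrow> 1"
    by (simp add: cdf_def[of "law _"] measure_law_atMost cdf)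
  have "\<forall>\<^sub>F n in sequentially. measure PP {\<omega>. match_count (starts n) (k n) \<omega> \<le> 1 / 2} \<le> 1 - c"
    using c(2)
  proof eventually_elim
    fix n assume n: "c \<le> measure PP {\<omega>. 0 < match_count (starts n) (k n) \<omega>}"
    have "{\<omega>\<in>space PP. 0 < match_count (starts n) (k n) \<omega>} \<in> sets PP" by measurable
    then have A: "{\<omega>. 0 < match_count (starts n) (k n) \<omega>} \<in> sets PP" by simp
    have half: "real c \<le> 1 / 2 \<longleftrightarrow> \<not> 0 < real c" for c by (cases c) auto
    have "match_count (starts n) (k n) \<omega> \<le> 1 / 2 \<longleftrightarrow> \<not> 0 < match_count (starts n) (k n) \<omega>"
      for \<omega> :: "'a config \<times> 'a config"
      by (subst (1 2) match_count_eq_card) (simp_all only: half finite_atLeastAtMost_int)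
    then have "{\<omega> :: 'a config \<times> 'a config. match_count (starts n) (k n) \<omega> \<le> 1 / 2}
        = UNIV - {\<omega>. 0 < match_count (starts n) (k n) \<omega>}"
      by auto
    then show "measure PP {\<omega>. match_count (starts n) (k n) \<omega> \<le> 1 / 2} \<le> 1 - c"
      using pair.prob_compl[OF A] n by simp
  qed
  with lim have "1 \<le> 1 - c"
    using tendsto_upperbound trivial_limit_sequentially by blast
  with c show False by simp
qed

end

theorem theorem5p3:
  fixes U :: "int set \<Rightarrow> 'a::finite config \<Rightarrow> real"
    and P :: "'a config measure"
    and \<alpha> :: real
    and kstar :: "nat \<Rightarrow> real"
    and k :: "nat \<Rightarrow> int"
  assumes "CARD('a) \<ge> 2"
    and "U \<in> interactions"
    and "gibbs_measure U P"
    and "\<alpha> = pressure U - pressure (\<lambda>A \<sigma>. 2 * U A \<sigma>) / 2"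
    and "\<And>n. kstar n = ln (real n) / \<alpha>"
    and "\<forall>\<^sub>F n in sequentially. 1 \<le> k n \<and> k n < int n"
  shows "\<alpha> > 0 \<and>
      (filterlim (\<lambda>n. kstar n - real_of_int (k n)) at_top sequentially \<longrightarrow>
      (\<forall>m::nat. m > 0 \<longrightarrow>
        (\<lambda>n. \<P>(x in P \<Otimes>\<^sub>M P. N_matches (fst x) (snd x) n (k n) \<le> m)) \<longlonglongrightarrow> 0)) \<and>
      (filterlim (\<lambda>n. real_of_int (k n) - kstar n) at_top sequentially \<longrightarrow>
      (\<forall>m::nat. m > 0 \<longrightarrow>
        (\<lambda>n. \<P>(x in P \<Otimes>\<^sub>M P. N_matches (fst x) (snd x) n (k n) \<ge> m)) \<longlonglongrightarrow> 0)) \<and>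
      (bounded (range (\<lambda>n. real_of_int (k n) - kstar n)) \<longrightarrow>
      tight (\<lambda>n. distr (P \<Otimes>\<^sub>M P) borel (\<lambda>x. real (N_matches (fst x) (snd x) n (k n)))) \<and>
      \<not> weak_conv_m (\<lambda>n. distr (P \<Otimes>\<^sub>M P) borel (\<lambda>x. real (N_matches (fst x) (snd x) n (k n))))
          (return borel 0) \<and>
      (\<exists>K>0. \<forall>m::nat. m > 0 \<longrightarrow>
        limsup (\<lambda>n. ereal (\<P>(x in P \<Otimes>\<^sub>M P. N_matches (fst x) (snd x) n (k n) > m)))
          \<le> ereal (K / real m)) \<and>
      liminf (\<lambda>n. ereal (\<P>(x in P \<Otimes>\<^sub>M P. N_matches (fst x) (snd x) n (k n) > 0))) > 0)"
proof -
  interpret gibbs U P by unfold_locales (fact assms)+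
  have \<alpha>: "\<alpha> = rate"
    using pressure_mult[of 1] pressure_mult[of 2] by (simp add: assms(4) rate_def)
  interpret matching U P kstar k
    by unfold_locales (use assms(1,6) in \<open>simp_all add: assms(5) \<alpha>\<close>)
  have count: "real (N_matches (fst x) (snd x) n (k n)) = match_count (starts n) (k n) x" for x n
    by (simp add: N_matches_eq_match_count)
  have le: "\<P>(x in P \<Otimes>\<^sub>M P. N_matches (fst x) (snd x) n (k n) \<le> m) =
      measure PP {\<omega>. match_count (starts n) (k n) \<omega> \<le> real m}" for n m
    by (simp add: count[symmetric])
  have ge: "\<P>(x in P \<Otimes>\<^sub>M P. N_matches (fst x) (snd x) n (k n) \<ge> m) =
      measure PP {\<omega>. real m \<le> match_count (starts n) (k n) \<omega>}" for n m
    by (simp add: count[symmetric])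
  have gt: "\<P>(x in P \<Otimes>\<^sub>M P. N_matches (fst x) (snd x) n (k n) > m) =
      measure PP {\<omega>. real m < match_count (starts n) (k n) \<omega>}" for n m
    by (simp add: count[symmetric])
  have tail: "\<exists>C>0. \<forall>m::nat. m > 0 \<longrightarrow>
        limsup (\<lambda>n. ereal (\<P>(x in P \<Otimes>\<^sub>M P. N_matches (fst x) (snd x) n (k n) > m))) \<le> ereal (C / real m)"
    if bdd: "bounded (range (\<lambda>n. real_of_int (k n) - kstar n))"
  proof -
    obtain C where C: "C > 0" "\<And>n. mean n \<le> C" using critical_mean_bounded[OF bdd] by blast
    \<comment> \<open>The mean is bounded for all n, so the tail bound holds for every n and passes
      to the upper limit.\<close>
    have "\<P>(x in P \<Otimes>\<^sub>M P. N_matches (fst x) (snd x) n (k n) > m) \<le> C / real m" if "m > 0" for m n :: nat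
    proof -
      have "{\<omega>\<in>space PP. real m \<le> match_count (starts n) (k n) \<omega>} \<in> sets PP" by measurable
      then have "measure PP {\<omega>. real m < match_count (starts n) (k n) \<omega>}
          \<le> measure PP {\<omega>. real m \<le> match_count (starts n) (k n) \<omega>}"
        by (intro pair.finite_measure_mono) auto
      also have "\<dots> \<le> mean n / real m" using that by (intro markov_match_count) auto
      also have "\<dots> \<le> C / real m" by (intro divide_right_mono C) simp
      finally show ?thesis by (simp only: gt)
    qed
    then show ?thesis using C(1) by (intro exI[of _ C] conjI allI impI Limsup_bounded always_eventually) simp_all
  qed
  have hit: "liminf (\<lambda>n. ereal (\<P>(x in P \<Otimes>\<^sub>M P. N_matches (fst x) (snd x) n (k n) > 0))) > 0"
    if bdd: "bounded (range (\<lambda>n. real_of_int (k n) - kstar n))"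
  proof -
    obtain c where c: "c > 0"
      "\<forall>\<^sub>F n in sequentially. c \<le> measure PP {\<omega>. 0 < match_count (starts n) (k n) \<omega>}"
      using critical_hit[OF bdd] by blast
    have "0 < ereal c" using c(1) by simp
    also have "ereal c \<le> liminf (\<lambda>n. ereal (\<P>(x in P \<Otimes>\<^sub>M P. N_matches (fst x) (snd x) n (k n) > 0)))"
      using c(2) unfolding gt by (intro Liminf_bounded) (auto elim: eventually_mono)
    finally show ?thesis .
  qed
  show ?thesis
  proof (intro conjI impI allI)
    show "\<alpha> > 0" using rate0 by (simp only: \<alpha>)
  qed ((rule tail hit; assumption) |
      (unfold le ge count; rule many_matches few_matches critical_tight critical_not_weak_conv; assumption))+
qed

end
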